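(* Let $G$ be a locally compact, Hausdorff, étale groupoid with finite dynamical complexity. Then $G$ is amenable.
   Context: For an étale groupoid $G$: $G^{(0)}$ is the unit space, $s,r:G\to G^{(0)}$ the source and range maps, $G_x=s^{-1}(x)$; $(g,h)$ is composable if $s(g)=r(h)$. **Finite dynamical complexity.** A subset of a topological space is relatively compact if its closure is compact. Let $H$ be an open subgroupoid of $G$ and $\mathcal{C}$ a set of open subgroupoids of $G$. $H$ is decomposable over $\mathcal{C}$ if for any open, relatively compact subset $K$ of $H$ there is an open cover $H^{(0)}=U_0\cup U_1$ of the unit space of $H$ such that for each $i\in\{0,1\}$ the subgroupoid of $H$ generated by $\{h\in K: s(h)\in U_i\}$ is in $\mathcal{C}$. Let $\mathcal{D}_g$ be the smallest set of open subgroupoids of $G$ that contains all relatively compact open subgroupoids and is closed under decomposability (if $H$ is decomposable over $\mathcal{D}_g$ then $H\in\mathcal{D}_g$). An open subgroupoid of $G$ (for example $G$ itself) has finite dynamical complexity if it is in $\mathcal{D}_g$. **Amenability.** $G$ is amenable if for all compact $K\subseteq G$ and all $\epsilon>0$ there is a continuous, compactly supported $\mu:G\to[0,1]$ such that: (i) $\sum_{g\in G_x}\mu(g)\le1$ for all $x\in G^{(0)}$; (ii) $|1-\sum_{g\in G_{r(k)}}\mu(g)|<\epsilon$ for all $k\in K$; (iii) $\sum_{g\in G_{r(k)}}|\mu(g)-\mu(gk)|<\epsilon$ for all $k\in K$. *)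

theory Defs
  imports "HOL-Analysis.Analysis"
begin

section \<open>Etale groupoids\<close>

text \<open>
  A groupoid is represented by its set of arrows, the carrier of the topology \<open>gtop G\<close>. Units are
  themselves arrows. The functions \<open>gsrc\<close>, \<open>grng\<close>, \<open>ginv\<close> matter only on arrows, and
  \<open>gmult\<close> only on composable pairs; their values elsewhere are irrelevant. The product \<open>g h\<close> is
  defined when \<open>s(g) = r(h)\<close>, so arrows compose like functions.
\<close>

record 'g groupoid_struct =
  gtop :: "'g topology"
  gsrc :: "'g \<Rightarrow> 'g"
  grng :: "'g \<Rightarrow> 'g"
  gmult :: "'g \<Rightarrow> 'g \<Rightarrow> 'g"
  ginv :: "'g \<Rightarrow> 'g"

abbreviation arrows :: "'g groupoid_struct \<Rightarrow> 'g set" where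
  "arrows G \<equiv> topspace (gtop G)"

definition units :: "'g groupoid_struct \<Rightarrow> 'g set" where
  "units G = gsrc G ` arrows G"

definition source_fibre :: "'g groupoid_struct \<Rightarrow> 'g \<Rightarrow> 'g set" where
  "source_fibre G x = {g \<in> arrows G. gsrc G g = x}"

definition composable :: "'g groupoid_struct \<Rightarrow> ('g \<times> 'g) set" where
  "composable G = {(g, h). g \<in> arrows G \<and> h \<in> arrows G \<and> gsrc G g = grng G h}"

locale groupoid =
  fixes G :: "'g groupoid_struct"
  assumes src_closed: "g \<in> arrows G \<Longrightarrow> gsrc G g \<in> arrows G"
    and rng_closed: "g \<in> arrows G \<Longrightarrow> grng G g \<in> arrows G"
    and src_src: "g \<in> arrows G \<Longrightarrow> gsrc G (gsrc G g) = gsrc G g"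
    and rng_src: "g \<in> arrows G \<Longrightarrow> grng G (gsrc G g) = gsrc G g"
    and src_rng: "g \<in> arrows G \<Longrightarrow> gsrc G (grng G g) = grng G g"
    and rng_rng: "g \<in> arrows G \<Longrightarrow> grng G (grng G g) = grng G g"
    and mult_closed: "(g, h) \<in> composable G \<Longrightarrow> gmult G g h \<in> arrows G"
    and src_mult: "(g, h) \<in> composable G \<Longrightarrow> gsrc G (gmult G g h) = gsrc G h"
    and rng_mult: "(g, h) \<in> composable G \<Longrightarrow> grng G (gmult G g h) = grng G g"
    and mult_assoc: "(g, h) \<in> composable G \<Longrightarrow> (h, k) \<in> composable G \<Longrightarrow>
          gmult G (gmult G g h) k = gmult G g (gmult G h k)"
    and mult_src: "g \<in> arrows G \<Longrightarrow> gmult G g (gsrc G g) = g"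
    and rng_mult_self: "g \<in> arrows G \<Longrightarrow> gmult G (grng G g) g = g"
    and inv_closed: "g \<in> arrows G \<Longrightarrow> ginv G g \<in> arrows G"
    and src_inv: "g \<in> arrows G \<Longrightarrow> gsrc G (ginv G g) = grng G g"
    and rng_inv: "g \<in> arrows G \<Longrightarrow> grng G (ginv G g) = gsrc G g"
    and inv_mult: "g \<in> arrows G \<Longrightarrow> gmult G (ginv G g) g = gsrc G g"
    and mult_inv: "g \<in> arrows G \<Longrightarrow> gmult G g (ginv G g) = grng G g"

locale topological_groupoid = groupoid +
  assumes continuous_mult:
      "continuous_map (subtopology (prod_topology (gtop G) (gtop G)) (composable G)) (gtop G)
         (\<lambda>(g, h). gmult G g h)"
    and continuous_inv: "continuous_map (gtop G) (gtop G) (ginv G)"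

definition local_homeomorphism :: "'a topology \<Rightarrow> 'b topology \<Rightarrow> ('a \<Rightarrow> 'b) \<Rightarrow> bool" where
  "local_homeomorphism X Y f \<longleftrightarrow>
     (\<forall>x \<in> topspace X. \<exists>U. openin X U \<and> x \<in> U \<and> openin Y (f ` U) \<and>
        homeomorphic_map (subtopology X U) (subtopology Y (f ` U)) f)"

locale etale_groupoid = topological_groupoid +
  assumes src_local_homeomorphism:
      "local_homeomorphism (gtop G) (subtopology (gtop G) (units G)) (gsrc G)"
    and rng_local_homeomorphism:
      "local_homeomorphism (gtop G) (subtopology (gtop G) (units G)) (grng G)"

section \<open>Finite dynamical complexity\<close>

definition relatively_compact_in :: "'a topology \<Rightarrow> 'a set \<Rightarrow> bool" where
  "relatively_compact_in X S \<longleftrightarrow> S \<subseteq> topspace X \<and> compactin X (X closure_of S)"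

text \<open>
  A subgroupoid need not contain all units of \<open>G\<close>, and the empty set is a subgroupoid.
\<close>

definition subgroupoid :: "'g groupoid_struct \<Rightarrow> 'g set \<Rightarrow> bool" where
  "subgroupoid G H \<longleftrightarrow>
     H \<subseteq> arrows G \<and>
     (\<forall>g \<in> H. gsrc G g \<in> H \<and> grng G g \<in> H \<and> ginv G g \<in> H) \<and>
     (\<forall>g \<in> H. \<forall>h \<in> H. gsrc G g = grng G h \<longrightarrow> gmult G g h \<in> H)"

definition open_subgroupoid :: "'g groupoid_struct \<Rightarrow> 'g set \<Rightarrow> bool" where
  "open_subgroupoid G H \<longleftrightarrow> subgroupoid G H \<and> openin (gtop G) H"

definition generated_subgroupoid :: "'g groupoid_struct \<Rightarrow> 'g set \<Rightarrow> 'g set \<Rightarrow> 'g set" where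
  "generated_subgroupoid G H S = (\<lambda>L. subgroupoid G L \<and> L \<subseteq> H) hull S"

text \<open>
  In the next definition \<open>K\<close> is relatively compact as a subset of the space \<open>H\<close>, that is, its
  closure in \<open>H\<close> is compact. The unit space of \<open>H\<close> is \<open>gsrc G ` H\<close>.
\<close>

definition decomposable_over ::
    "'g groupoid_struct \<Rightarrow> 'g set \<Rightarrow> 'g set set \<Rightarrow> bool" where
  "decomposable_over G H C \<longleftrightarrow>
     (\<forall>K. openin (subtopology (gtop G) H) K \<and>
          relatively_compact_in (subtopology (gtop G) H) K \<longrightarrow>
        (\<exists>U0 U1. openin (subtopology (gtop G) (gsrc G ` H)) U0 \<and>
                 openin (subtopology (gtop G) (gsrc G ` H)) U1 \<and>
                 gsrc G ` H = U0 \<union> U1 \<and>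
                 generated_subgroupoid G H {h \<in> K. gsrc G h \<in> U0} \<in> C \<and>
                 generated_subgroupoid G H {h \<in> K. gsrc G h \<in> U1} \<in> C))"

definition closed_under_decomposability ::
    "'g groupoid_struct \<Rightarrow> 'g set set \<Rightarrow> bool" where
  "closed_under_decomposability G D \<longleftrightarrow>
     (\<forall>H. open_subgroupoid G H \<and> decomposable_over G H D \<longrightarrow> H \<in> D)"

definition fdc_class :: "'g groupoid_struct \<Rightarrow> 'g set set" where
  "fdc_class G =
     \<Inter>{D. D \<subseteq> Collect (open_subgroupoid G) \<and>
         (\<forall>H. open_subgroupoid G H \<and> relatively_compact_in (gtop G) H \<longrightarrow> H \<in> D) \<and>
         closed_under_decomposability G D}"

lemma decomposable_over_mono:
  "decomposable_over G H C \<Longrightarrow> C \<subseteq> D \<Longrightarrow> decomposable_over G H D"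
  unfolding decomposable_over_def by (meson subsetD)

lemma fdc_class_open_subgroupoid: "fdc_class G \<subseteq> Collect (open_subgroupoid G)"
  unfolding fdc_class_def closed_under_decomposability_def by (intro Inter_lower) auto

lemma fdc_class_relatively_compact:
  "open_subgroupoid G H \<Longrightarrow> relatively_compact_in (gtop G) H \<Longrightarrow> H \<in> fdc_class G"
  unfolding fdc_class_def by auto

lemma fdc_class_closed_under_decomposability: "closed_under_decomposability G (fdc_class G)"
  unfolding closed_under_decomposability_def
proof (intro allI impI, elim conjE)
  fix H assume H: "open_subgroupoid G H" "decomposable_over G H (fdc_class G)"
  show "H \<in> fdc_class G"
    unfolding fdc_class_def
  proof (rule InterI)
    fix D assume D: "D \<in> {D. D \<subseteq> Collect (open_subgroupoid G) \<and>
         (\<forall>H. open_subgroupoid G H \<and> relatively_compact_in (gtop G) H \<longrightarrow> H \<in> D) \<and>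
         closed_under_decomposability G D}"
    then have "fdc_class G \<subseteq> D"
      unfolding fdc_class_def by (rule Inter_lower)
    with H(2) have "decomposable_over G H D" by (rule decomposable_over_mono)
    with H(1) D show "H \<in> D" unfolding closed_under_decomposability_def by blast
  qed
qed

definition finite_dynamical_complexity :: "'g groupoid_struct \<Rightarrow> bool" where
  "finite_dynamical_complexity G \<longleftrightarrow> arrows G \<in> fdc_class G"

section \<open>Amenability\<close>

text \<open>
  In a Hausdorff etale groupoid the source fibres are closed and discrete, so for compactly supported
  \<open>\<mu>\<close> all sums below have only finitely many nonzero terms; in particular the convention that
  \<^const>\<open>infsum\<close> of a non-summable family is zero plays no role.
\<close>

definition amenable_groupoid :: "'g groupoid_struct \<Rightarrow> bool" where
  "amenable_groupoid G \<longleftrightarrow>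
     (\<forall>K \<epsilon>. compactin (gtop G) K \<and> \<epsilon> > 0 \<longrightarrow>
        (\<exists>\<mu> :: 'g \<Rightarrow> real.
           continuous_map (gtop G) (top_of_set {0..1}) \<mu> \<and>
           compactin (gtop G) (gtop G closure_of {g \<in> arrows G. \<mu> g \<noteq> 0}) \<and>
           (\<forall>x \<in> units G. (\<Sum>\<^sub>\<infinity>g\<in>source_fibre G x. \<mu> g) \<le> 1) \<and>
           (\<forall>k \<in> K. \<bar>1 - (\<Sum>\<^sub>\<infinity>g\<in>source_fibre G (grng G k). \<mu> g)\<bar> < \<epsilon>) \<and>
           (\<forall>k \<in> K. (\<Sum>\<^sub>\<infinity>g\<in>source_fibre G (grng G k). \<bar>\<mu> g - \<mu> (gmult G g k)\<bar>) < \<epsilon>)))"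

end

theory Submission
  imports Defs
begin

text \<open>
  An open subgroupoid \<open>H\<close> is called amenable on its own if for every compact \<open>K \<subseteq> H\<close> there are
  approximately \<open>K\<close>-invariant means \<open>\<mu> \<ge> 0\<close>, continuous and with compact support inside \<open>H\<close>, whose
  fibre sums are at most 1 everywhere and equal to 1 over the source and range of every \<open>k \<in> K\<close>
  (\<open>amenable_on\<close>). The open subgroupoids with this property contain the relatively compact ones and
  are closed under decomposability, hence contain the whole class generated by these two rules; for
  \<open>H = G\<close> the property implies amenability of \<open>G\<close>.

  Both closure properties rest on slow bump functions (\<open>slow_bump\<close>): for compact \<open>K \<subseteq> H\<close> and
  \<open>\<delta> > 0\<close> there is \<open>w\<close>, continuous with compact support in \<open>H\<close> and values in \<open>[0,1]\<close>, with \<open>w = 1\<close>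
  on \<open>K\<close> and \<open>\<bar>w(h) - w(hk)\<bar> \<le> \<delta>\<close> for \<open>k \<in> K\<close>. If \<open>H\<close> is relatively compact, its source fibres have
  at most \<open>N\<close> elements for some \<open>N\<close>, so \<open>w\<close> itself moves by at most \<open>N \<delta>\<close> in the sum norm along
  \<open>K\<close>; dividing by fibre sums turns it into a mean (\<open>amenable_on_relatively_compact\<close>).

  If \<open>H\<close> is decomposable, let \<open>K\<close> be symmetric, let \<open>L\<close> be the support of a slow \<open>w\<close>, and take the
  cover \<open>U\<^sub>0, U\<^sub>1\<close> of the unit space for a relatively compact open set containing \<open>L\<inverse>\<close> and \<open>K L\<inverse>\<close>.
  With a bump \<open>\<psi>\<^sub>i\<close> supported in \<open>U\<^sub>i\<close>, the function
  \<open>\<phi>\<^sub>i(x) = max {w(h) \<psi>\<^sub>i(r(h)) | s(h) = x}\<close> on units inherits slow variation from \<open>w\<close>,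
  because \<open>h\<close> and \<open>hk\<close> have the same range.
  If \<open>\<phi>\<^sub>i\<close> is nonzero at \<open>s(k)\<close>, some \<open>h \<in> L\<close> leads from \<open>s(k)\<close> into \<open>U\<^sub>i\<close>, and
  \<open>k = (k h\<inverse>) h\<close> lies in the subgroupoid \<open>H\<^sub>i\<close> generated over \<open>U\<^sub>i\<close>; so means \<open>\<mu>\<^sub>i\<close> for \<open>H\<^sub>i\<close>
  are almost invariant wherever \<open>\<phi>\<^sub>i\<close> is felt, and \<open>\<Sum>\<^sub>i \<phi>\<^sub>i(s(g)) \<mu>\<^sub>i(g)\<close> is, up to normalisation, the
  required mean for \<open>H\<close> (\<open>localised_mean\<close>, \<open>amenable_on_decomposable\<close>).
\<close>

section \<open>Topology\<close>

lemma local_homeomorphism_imp_continuous_map: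
  assumes "local_homeomorphism X Y f"
  shows "continuous_map X Y f"
  unfolding continuous_map
proof (intro conjI allI impI)
  show "f ` topspace X \<subseteq> topspace Y"
    using assms unfolding local_homeomorphism_def by (metis image_subsetI imageI openin_subset subsetD)
  fix W assume W: "openin Y W"
  show "openin X {x \<in> topspace X. f x \<in> W}"
  proof (subst openin_subopen, intro ballI)
    fix x assume x: "x \<in> {x \<in> topspace X. f x \<in> W}"
    then obtain U where U: "openin X U" "x \<in> U"
      "homeomorphic_map (subtopology X U) (subtopology Y (f ` U)) f"
      using assms unfolding local_homeomorphism_def by blast
    then have "continuous_map (subtopology X U) Y f"
      using homeomorphic_imp_continuous_map continuous_map_in_subtopology by blast
    then have "openin (subtopology X U) {y \<in> topspace (subtopology X U). f y \<in> W}"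
      using W by (rule openin_continuous_map_preimage)
    then have "openin X {y \<in> topspace (subtopology X U). f y \<in> W}"
      using U(1) openin_trans_full by blast
    then show "\<exists>T. openin X T \<and> x \<in> T \<and> T \<subseteq> {x \<in> topspace X. f x \<in> W}"
      using x U(2) by (intro exI[of _ "{y \<in> topspace (subtopology X U). f y \<in> W}"]) auto
  qed
qed

lemma local_homeomorphism_imp_open_map:
  assumes "local_homeomorphism X Y f"
  shows "open_map X Y f"
  unfolding open_map_def
proof (intro allI impI)
  fix W assume W: "openin X W"
  show "openin Y (f ` W)"
  proof (subst openin_subopen, intro ballI)
    fix y assume "y \<in> f ` W"
    then obtain x where x: "x \<in> W" "y = f x" by blast
    with W have "x \<in> topspace X" using openin_subset by blast
    then obtain U where U: "openin X U" "x \<in> U" "openin Y (f ` U)"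
      "homeomorphic_map (subtopology X U) (subtopology Y (f ` U)) f"
      using assms unfolding local_homeomorphism_def by blast
    have "openin (subtopology X U) (U \<inter> W)"
      using W by (simp add: openin_subtopology_Int2)
    then have "openin (subtopology Y (f ` U)) (f ` (U \<inter> W))"
      using U(4) homeomorphic_imp_open_map open_map_def by blast
    then have "openin Y (f ` (U \<inter> W))"
      using U(3) openin_trans_full by blast
    then show "\<exists>T. openin Y T \<and> y \<in> T \<and> T \<subseteq> f ` W"
      using x U(2) by (intro exI[of _ "f ` (U \<inter> W)"]) auto
  qed
qed

lemma local_homeomorphism_imp_locally_injective:
  assumes "local_homeomorphism X Y f" and "x \<in> topspace X"
  obtains U where "openin X U" "x \<in> U" "inj_on f U"
proof -
  obtain U where U: "openin X U" "x \<in> U"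
      "homeomorphic_map (subtopology X U) (subtopology Y (f ` U)) f"
    using assms unfolding local_homeomorphism_def by blast
  moreover have "inj_on f U"
    using homeomorphic_imp_injective_map[OF U(3)] openin_subset[OF U(1)]
    by (simp add: inf.absorb2)
  ultimately show ?thesis using that by blast
qed

lemma compact_nbhd_in_open:
  assumes lc: "locally_compact_space X" and hd: "Hausdorff_space X"
    and C: "compactin X C" and U: "openin X U" and CU: "C \<subseteq> U"
  obtains V A where "openin X V" "compactin X A" "C \<subseteq> V" "V \<subseteq> A" "A \<subseteq> U"
proof -
  have lcU: "locally_compact_space (subtopology X U)"
    by (rule locally_compact_space_open_subset[OF _ lc U]) (simp add: hd)
  have hdU: "Hausdorff_space (subtopology X U)"
    by (simp add: Hausdorff_space_subtopology hd)
  have "compactin (subtopology X U) C" using C CU by (simp add: compactin_subtopology)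
  then obtain V A where "openin (subtopology X U) V" "compactin (subtopology X U) A"
      "C \<subseteq> V" "V \<subseteq> A"
    using lcU locally_compact_space_compact_closed_compact[of "subtopology X U"] hdU by metis
  moreover from this have "openin X V" using U openin_trans_full by blast
  ultimately show ?thesis using that by (auto simp: compactin_subtopology)
qed

lemma compact_split_two_open:
  assumes lc: "locally_compact_space X" and hd: "Hausdorff_space X"
    and C: "compactin X C" and U: "openin X U0" "openin X U1" and CU: "C \<subseteq> U0 \<union> U1"
  obtains C0 C1 where "compactin X C0" "compactin X C1" "C0 \<subseteq> U0" "C1 \<subseteq> U1" "C = C0 \<union> C1"
proof -
  have diff: "compactin X (C - W)" if "openin X W" for W
  proof -
    have "C - W = C \<inter> (topspace X - W)" using compactin_subset_topspace[OF C] by auto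
    moreover have "closedin X (topspace X - W)" using that by blast
    ultimately show ?thesis using C compact_Int_closedin by metis
  qed
  obtain V A where VA: "openin X V" "compactin X A" "C - U1 \<subseteq> V" "V \<subseteq> A" "A \<subseteq> U0"
    by (rule compact_nbhd_in_open[OF lc hd diff[OF U(2)] U(1)]) (use CU in auto)
  show ?thesis
  proof
    show "compactin X (C \<inter> A)"
      using C VA(2) hd compactin_imp_closedin compact_Int_closedin by blast
    show "compactin X (C - V)" using diff VA(1) .
  qed (use VA in auto)
qed


section \<open>Arrows and fibres of an etale groupoid\<close>

text \<open>
  For open \<open>H\<close>, the functions in \<open>Cc G H\<close> are the compactly supported continuous functions on \<open>H\<close>, extended by
  zero to \<open>G\<close>. Keeping them on \<open>G\<close> lets functions that belong to different subgroupoids be added.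
\<close>

definition Cc :: "'g groupoid_struct \<Rightarrow> 'g set \<Rightarrow> ('g \<Rightarrow> real) set" where
  "Cc G H = {f. continuous_map (gtop G) euclideanreal f \<and>
     (\<exists>L. compactin (gtop G) L \<and> L \<subseteq> H \<and> (\<forall>g \<in> arrows G. f g \<noteq> 0 \<longrightarrow> g \<in> L))}"

definition fibre_sum :: "'g groupoid_struct \<Rightarrow> ('g \<Rightarrow> real) \<Rightarrow> 'g \<Rightarrow> real" where
  "fibre_sum G f x = (\<Sum>\<^sub>\<infinity>g\<in>source_fibre G x. f g)"

definition displacement :: "'g groupoid_struct \<Rightarrow> ('g \<Rightarrow> real) \<Rightarrow> 'g \<Rightarrow> real" where
  "displacement G f k = (\<Sum>\<^sub>\<infinity>g\<in>source_fibre G (grng G k). \<bar>f g - f (gmult G g k)\<bar>)"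

text \<open>
  Fibre sums equal to 1, not merely close to 1, over the sources and ranges of \<open>K\<close> make the fibre
  sums of \<open>\<phi> \<cdot> \<mu>\<close> equal to \<open>\<phi>\<close> there, where \<open>\<phi>\<close> is a function on units; two such pieces can then be
  added with control of the total mass. The support lies in \<open>H\<close>, so that a mean for a subgroupoid
  is also a function on any larger one.
\<close>

definition amenable_on :: "'g groupoid_struct \<Rightarrow> 'g set \<Rightarrow> bool" where
  "amenable_on G H \<longleftrightarrow>
     (\<forall>K \<epsilon>. compactin (gtop G) K \<and> K \<subseteq> H \<and> \<epsilon> > 0 \<longrightarrow>
        (\<exists>\<mu> \<in> Cc G H. (\<forall>g \<in> arrows G. 0 \<le> \<mu> g) \<and>
           (\<forall>x \<in> units G. fibre_sum G \<mu> x \<le> 1) \<and>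
           (\<forall>k \<in> K. fibre_sum G \<mu> (gsrc G k) = 1 \<and> fibre_sum G \<mu> (grng G k) = 1 \<and>
              displacement G \<mu> k < \<epsilon>)))"

definition set_mult :: "'g groupoid_struct \<Rightarrow> 'g set \<Rightarrow> 'g set \<Rightarrow> 'g set" where
  "set_mult G A B = {gmult G g h | g h. g \<in> A \<and> h \<in> B \<and> gsrc G g = grng G h}"

lemma set_multI:
  "g \<in> A \<Longrightarrow> h \<in> B \<Longrightarrow> gsrc G g = grng G h \<Longrightarrow> gmult G g h \<in> set_mult G A B"
  unfolding set_mult_def by blast

locale lch_etale_groupoid = etale_groupoid +
  assumes lc: "locally_compact_space (gtop G)"
    and hd: "Hausdorff_space (gtop G)"
begin

abbreviation "X \<equiv> gtop G"
abbreviation "s \<equiv> gsrc G"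
abbreviation "r \<equiv> grng G"
abbreviation inverse_arrow ("inv") where "inv \<equiv> ginv G"
abbreviation mul (infixl "\<cdot>" 70) where "g \<cdot> h \<equiv> gmult G g h"

lemma composable_iff: "(g, h) \<in> composable G \<longleftrightarrow> g \<in> arrows G \<and> h \<in> arrows G \<and> s g = r h"
  by (simp add: composable_def)

lemma units_iff: "x \<in> units G \<longleftrightarrow> x \<in> arrows G \<and> s x = x"
  unfolding units_def using src_closed src_src by (metis image_iff)

lemma src_in_units: "g \<in> arrows G \<Longrightarrow> s g \<in> units G"
  by (simp add: units_def)

lemma rng_in_units: "g \<in> arrows G \<Longrightarrow> r g \<in> units G"
  by (simp add: units_iff rng_closed src_rng)

lemma source_fibre_iff: "g \<in> source_fibre G x \<longleftrightarrow> g \<in> arrows G \<and> s g = x"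
  by (simp add: source_fibre_def)

lemma mul_inv_cancel:
  assumes "g \<in> arrows G" "k \<in> arrows G" "s g = r k"
  shows "g \<cdot> k \<cdot> inv k = g"
  using assms mult_assoc[of g k "inv k"] mult_inv[of k] mult_src[of g]
  by (simp add: composable_iff inv_closed rng_inv)

lemma inv_mul_cancel:
  assumes "g \<in> arrows G" "k \<in> arrows G" "s g = s k"
  shows "g \<cdot> inv k \<cdot> k = g"
  using assms mult_assoc[of g "inv k" k] inv_mult[of k] mult_src[of g]
  by (simp add: composable_iff inv_closed rng_inv src_inv)

lemma inv_inv: "g \<in> arrows G \<Longrightarrow> inv (inv g) = g"
  using mul_inv_cancel[of g "inv g"] inv_mul_cancel[of g "g"]
    mult_assoc[of g "inv g" "inv (inv g)"] mult_assoc[of "inv (inv g)" "inv g" g]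
  by (metis composable_iff inv_closed inv_mult mult_src rng_inv rng_mult_self src_inv)

lemma bij_betw_fibres:
  assumes "k \<in> arrows G"
  shows "bij_betw (\<lambda>g. g \<cdot> k) (source_fibre G (r k)) (source_fibre G (s k))"
  by (rule bij_betw_byWitness[where f' = "\<lambda>g. g \<cdot> inv k"])
     (use assms in \<open>auto simp: source_fibre_iff mul_inv_cancel inv_mul_cancel composable_iff
        inv_closed src_inv rng_inv mult_closed src_mult\<close>)

text \<open>Openness of the unit space makes the source map open as a map from \<open>G\<close> to itself.\<close>

lemma units_open: "openin X (units G)"
proof (subst openin_subopen, intro ballI)
  fix x assume x: "x \<in> units G"
  have cont: "continuous_map X X s"
    using local_homeomorphism_imp_continuous_map[OF src_local_homeomorphism]
    by (simp add: continuous_map_in_subtopology)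
  obtain U where U: "openin X U" "x \<in> U" "inj_on s U"
    using local_homeomorphism_imp_locally_injective[OF src_local_homeomorphism] x units_iff by metis
  \<comment> \<open>An arrow \<open>g\<close> and the unit \<open>s(g)\<close> have the same source, so they coincide if both lie in \<open>U\<close>.\<close>
  have "U \<inter> {g \<in> topspace X. s g \<in> U} \<subseteq> units G"
    using U(3) by (auto simp: units_iff src_src inj_on_def)
  moreover have "openin X (U \<inter> {g \<in> topspace X. s g \<in> U})"
    using cont U(1) openin_continuous_map_preimage by blast
  ultimately show "\<exists>T. openin X T \<and> x \<in> T \<and> T \<subseteq> units G"
    using U(2) x units_iff by (intro exI[of _ "U \<inter> {g \<in> topspace X. s g \<in> U}"]) auto
qed

lemma continuous_src: "continuous_map X X s"
  using local_homeomorphism_imp_continuous_map[OF src_local_homeomorphism]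
  by (simp add: continuous_map_in_subtopology)

lemma continuous_rng: "continuous_map X X r"
  using local_homeomorphism_imp_continuous_map[OF rng_local_homeomorphism]
  by (simp add: continuous_map_in_subtopology)

lemma open_src_image:
  assumes "openin X W" shows "openin X (s ` W)"
proof -
  have "openin (subtopology X (units G)) (s ` W)"
    using local_homeomorphism_imp_open_map[OF src_local_homeomorphism] assms
    by (simp add: open_map_def)
  then show ?thesis using units_open openin_trans_full by blast
qed

lemma compact_closed: "compactin X A \<Longrightarrow> closedin X A"
  using hd compactin_imp_closedin by blast

text \<open>
  As \<open>G\<close> is Hausdorff, the composable pairs form a closed subset of \<open>G \<times> G\<close>; those in \<open>A \<times> B\<close> are
  compact.
\<close>

lemma compact_set_mult:
  assumes A: "compactin X A" and B: "compactin X B"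
  shows "compactin X (set_mult G A B)"
proof -
  let ?P = "prod_topology X X"
  have "closedin ?P {p \<in> topspace ?P. s (fst p) = r (snd p)}"
    using continuous_map_compose[OF continuous_map_fst continuous_src, of X]
      continuous_map_compose[OF continuous_map_snd continuous_rng, of X]
    by (intro closedin_continuous_maps_eq[OF hd]) (auto simp: o_def)
  then have "compactin ?P ((A \<times> B) \<inter> {p \<in> topspace ?P. s (fst p) = r (snd p)})"
    using A B by (intro compact_Int_closedin) (auto simp: compactin_Times)
  also have "(A \<times> B) \<inter> {p \<in> topspace ?P. s (fst p) = r (snd p)} = (A \<times> B) \<inter> composable G"
    by (auto simp: composable_iff)
  finally have "compactin (subtopology ?P (composable G)) ((A \<times> B) \<inter> composable G)"
    by (simp add: compactin_subtopology)
  then have "compactin X ((\<lambda>(g, h). g \<cdot> h) ` ((A \<times> B) \<inter> composable G))"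
    using continuous_mult by (rule image_compactin)
  also have "(\<lambda>(g, h). g \<cdot> h) ` ((A \<times> B) \<inter> composable G) = set_mult G A B"
    using compactin_subset_topspace[OF A] compactin_subset_topspace[OF B]
    by (fastforce simp: set_mult_def composable_iff)
  finally show ?thesis .
qed

lemma compact_inv_image: "compactin X A \<Longrightarrow> compactin X (inv ` A)"
  using continuous_inv image_compactin by blast

lemma compact_finite_bisection_cover:
  assumes L: "compactin X L"
  obtains \<B> where "finite \<B>" "L \<subseteq> \<Union>\<B>" "\<And>B. B \<in> \<B> \<Longrightarrow> openin X B \<and> inj_on s B"
proof -
  have "\<exists>\<F>. finite \<F> \<and> \<F> \<subseteq> {B. openin X B \<and> inj_on s B} \<and> L \<subseteq> \<Union>\<F>"
  proof (rule compactinD[OF L])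
    show "L \<subseteq> \<Union>{B. openin X B \<and> inj_on s B}"
    proof
      fix g assume "g \<in> L"
      then have "g \<in> arrows G" using compactin_subset_topspace[OF L] by blast
      then show "g \<in> \<Union>{B. openin X B \<and> inj_on s B}"
        using local_homeomorphism_imp_locally_injective[OF src_local_homeomorphism]
        by (metis (mono_tags, lifting) UnionI mem_Collect_eq)
    qed
  qed auto
  then show ?thesis using that by blast
qed

text \<open>
  A source fibre meets each bisection in at most one arrow, so the number of bisections that cover
  \<open>L\<close> serves for all fibres.
\<close>

lemma compact_fibre_bounded:
  assumes L: "compactin X L"
  obtains N where "\<And>x. finite (source_fibre G x \<inter> L) \<and> card (source_fibre G x \<inter> L) \<le> N"
proof -
  obtain \<B> where \<B>: "finite \<B>" "L \<subseteq> \<Union>\<B>" "\<And>B. B \<in> \<B> \<Longrightarrow> openin X B \<and> inj_on s B"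
    using compact_finite_bisection_cover[OF L] by metis
  show ?thesis
  proof
    fix x
    define c where "c g = (SOME B. B \<in> \<B> \<and> g \<in> B)" for g
    have c: "c g \<in> \<B> \<and> g \<in> c g" if "g \<in> L" for g
      unfolding c_def by (rule someI_ex) (use that \<B>(2) in blast)
    have inj: "inj_on c (source_fibre G x \<inter> L)"
    proof (rule inj_onI)
      fix g h assume gh: "g \<in> source_fibre G x \<inter> L" "h \<in> source_fibre G x \<inter> L" "c g = c h"
      then have "inj_on s (c g)" "g \<in> c g" "h \<in> c g" using c \<B>(3) by auto
      then show "g = h" using gh by (auto simp: source_fibre_iff inj_on_def)
    qed
    have sub: "c ` (source_fibre G x \<inter> L) \<subseteq> \<B>" using c by auto
    show "finite (source_fibre G x \<inter> L) \<and> card (source_fibre G x \<inter> L) \<le> card \<B>"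
      using inj_on_finite[OF inj sub \<B>(1)] card_inj_on_le[OF inj sub \<B>(1)] by blast
  qed
qed

section \<open>Functions of compact support and their fibre sums\<close>

lemma bump_function:
  assumes C: "compactin X C" and U: "openin X U" and CU: "C \<subseteq> U"
  obtains b where "b \<in> Cc G U" "\<And>g. g \<in> arrows G \<Longrightarrow> 0 \<le> b g \<and> b g \<le> 1" "\<And>g. g \<in> C \<Longrightarrow> b g = 1"
proof -
  obtain V A where VA: "openin X V" "compactin X A" "C \<subseteq> V" "V \<subseteq> A" "A \<subseteq> U"
    using compact_nbhd_in_open[OF lc hd C U CU] .
  have cr: "completely_regular_space X"
    using lc hd locally_compact_regular_imp_completely_regular_space by blast
  have "closedin X (topspace X - V)" "disjnt C (topspace X - V)"
    using VA by (auto simp: disjnt_def)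
  then obtain b where b: "continuous_map X (top_of_set {0..1::real}) b"
      "b ` (topspace X - V) \<subseteq> {0}" "b ` C \<subseteq> {1}"
    using Urysohn_completely_regular_compact_closed[of 0 1 X C "topspace X - V"] cr C by auto
  show ?thesis
  proof
    have "g \<in> A" if "g \<in> arrows G" "b g \<noteq> 0" for g
      using that b(2) VA(4) by blast
    then show "b \<in> Cc G U"
      using b(1) VA(2,5) unfolding Cc_def continuous_map_in_subtopology by blast
  qed (use b in \<open>auto simp: continuous_map_in_subtopology Pi_iff\<close>)
qed

lemma Cc_continuous: "f \<in> Cc G H \<Longrightarrow> continuous_map X euclideanreal f"
  by (simp add: Cc_def)

lemma Cc_support:
  assumes "f \<in> Cc G H"
  obtains L where "compactin X L" "L \<subseteq> H" "\<And>g. g \<in> arrows G \<Longrightarrow> f g \<noteq> 0 \<Longrightarrow> g \<in> L"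
  using assms unfolding Cc_def by blast

lemma CcI:
  assumes "continuous_map X euclideanreal f" "compactin X L" "L \<subseteq> H"
    and "\<And>g. g \<in> arrows G \<Longrightarrow> f g \<noteq> 0 \<Longrightarrow> g \<in> L"
  shows "f \<in> Cc G H"
  using assms unfolding Cc_def by blast

lemma Cc_mono: "f \<in> Cc G H \<Longrightarrow> H \<subseteq> H' \<Longrightarrow> f \<in> Cc G H'"
  unfolding Cc_def by blast

lemma Cc_add:
  assumes "f \<in> Cc G H" "g \<in> Cc G H"
  shows "(\<lambda>x. f x + g x) \<in> Cc G H"
proof -
  obtain L M where L: "compactin X L" "L \<subseteq> H" "\<And>x. x \<in> arrows G \<Longrightarrow> f x \<noteq> 0 \<Longrightarrow> x \<in> L"
    and M: "compactin X M" "M \<subseteq> H" "\<And>x. x \<in> arrows G \<Longrightarrow> g x \<noteq> 0 \<Longrightarrow> x \<in> M"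
    using assms by (meson Cc_support)
  show ?thesis
  proof (rule CcI)
    show "compactin X (L \<union> M)" using L M by (simp add: compactin_Un)
    show "continuous_map X euclideanreal (\<lambda>x. f x + g x)"
      using assms by (intro continuous_map_add Cc_continuous)
    show "x \<in> L \<union> M" if "x \<in> arrows G" "f x + g x \<noteq> 0" for x
      using that L(3)[of x] M(3)[of x] by fastforce
  qed (use L M in auto)
qed

lemma Cc_mult:
  assumes "f \<in> Cc G H" "continuous_map X euclideanreal h"
  shows "(\<lambda>x. h x * f x) \<in> Cc G H"
proof -
  obtain L where L: "compactin X L" "L \<subseteq> H" "\<And>x. x \<in> arrows G \<Longrightarrow> f x \<noteq> 0 \<Longrightarrow> x \<in> L"
    using assms(1) Cc_support by blast
  show ?thesis
    by (rule CcI[OF _ L(1,2)])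
       (use L(3) assms in \<open>auto intro!: continuous_map_real_mult simp: Cc_continuous\<close>)
qed

lemma Cc_finite_fibre:
  assumes "f \<in> Cc G H"
  shows "finite {g \<in> source_fibre G x. f g \<noteq> 0}"
proof -
  obtain L where L: "compactin X L" "\<And>g. g \<in> arrows G \<Longrightarrow> f g \<noteq> 0 \<Longrightarrow> g \<in> L"
    using assms Cc_support by metis
  have "{g \<in> source_fibre G x. f g \<noteq> 0} \<subseteq> source_fibre G x \<inter> L"
    using L(2) by (auto simp: source_fibre_iff)
  then show ?thesis
    using compact_fibre_bounded[OF L(1)] by (metis finite_subset)
qed

lemma Cc_summable: "f \<in> Cc G H \<Longrightarrow> f summable_on source_fibre G x"
  by (intro finite_nonzero_values_imp_summable_on Cc_finite_fibre)

text \<open>The element 0 gives the value on arrows that are not units, whose source fibre is empty.\<close>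

definition fibre_max :: "('a \<Rightarrow> real) \<Rightarrow> 'a \<Rightarrow> real" where
  "fibre_max f x = Max (insert 0 (f ` source_fibre G x))"

lemma fibre_max_finite:
  assumes "f \<in> Cc G H"
  shows "finite (insert 0 (f ` source_fibre G x))"
proof -
  have "insert 0 (f ` source_fibre G x) \<subseteq> insert 0 (f ` {g \<in> source_fibre G x. f g \<noteq> 0})" by auto
  then show ?thesis using Cc_finite_fibre[OF assms] by (meson finite_imageI finite_insert finite_subset)
qed

lemma fibre_max_nonneg: "f \<in> Cc G H \<Longrightarrow> 0 \<le> fibre_max f x"
  unfolding fibre_max_def using fibre_max_finite by (intro Max_ge) auto

lemma fibre_max_ge: "f \<in> Cc G H \<Longrightarrow> g \<in> arrows G \<Longrightarrow> f g \<le> fibre_max f (s g)"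
  unfolding fibre_max_def using fibre_max_finite by (intro Max_ge) (auto simp: source_fibre_iff)

lemma fibre_max_le:
  assumes "f \<in> Cc G H" "0 \<le> a" "\<And>g. g \<in> source_fibre G x \<Longrightarrow> f g \<le> a"
  shows "fibre_max f x \<le> a"
  unfolding fibre_max_def using fibre_max_finite[OF assms(1)] assms by (subst Max_le_iff) auto

lemma fibre_max_attained:
  assumes "f \<in> Cc G H" "fibre_max f x \<noteq> 0"
  obtains g where "g \<in> arrows G" "s g = x" "f g = fibre_max f x"
proof -
  have "fibre_max f x \<in> insert 0 (f ` source_fibre G x)"
    unfolding fibre_max_def using fibre_max_finite[OF assms(1)] by (intro Max_in) auto
  then show ?thesis using assms(2) that by (auto simp: source_fibre_iff)
qed

text \<open>
  The superlevel sets are images of open sets under the open map \<open>s\<close>, and, at positive levels, the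
  closed ones are images of compact sets.
\<close>

lemma fibre_max_continuous:
  assumes f: "f \<in> Cc G H"
  shows "continuous_map X euclideanreal (fibre_max f)"
  unfolding continuous_map_upper_lower_semicontinuous_lt
proof (intro conjI allI)
  fix a :: real
  show "openin X {x \<in> topspace X. a < fibre_max f x}"
  proof (cases "a < 0")
    case True
    then have "{x \<in> topspace X. a < fibre_max f x} = topspace X"
      using fibre_max_nonneg[OF f] by (auto intro: less_le_trans)
    then show ?thesis by simp
  next
    case False
    have "{x \<in> topspace X. a < fibre_max f x} = s ` {g \<in> topspace X. a < f g}"
    proof (intro equalityI subsetI)
      fix x assume "x \<in> {x \<in> topspace X. a < fibre_max f x}"
      then show "x \<in> s ` {g \<in> topspace X. a < f g}"
        using False fibre_max_attained[OF f, of x] by (smt (verit, best) image_eqI mem_Collect_eq)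
    next
      fix x assume "x \<in> s ` {g \<in> topspace X. a < f g}"
      then obtain g where "g \<in> arrows G" "a < f g" "x = s g" by auto
      then show "x \<in> {x \<in> topspace X. a < fibre_max f x}"
        using fibre_max_ge[OF f, of g] src_closed by auto
    qed
    moreover have "openin X {g \<in> topspace X. a < f g}"
      using Cc_continuous[OF f] by (simp add: continuous_map_upper_lower_semicontinuous_lt)
    ultimately show ?thesis using open_src_image by simp
  qed
  show "openin X {x \<in> topspace X. fibre_max f x < a}"
  proof (cases "a \<le> 0")
    case True
    then have "\<not> fibre_max f x < a" for x
      using fibre_max_nonneg[OF f, of x] by simp
    then show ?thesis by simp
  next
    case False
    obtain L where L: "compactin X L" "\<And>g. g \<in> arrows G \<Longrightarrow> f g \<noteq> 0 \<Longrightarrow> g \<in> L"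
      using f Cc_support by metis
    let ?C = "L \<inter> {g \<in> topspace X. a \<le> f g}"
    have "closedin X {g \<in> topspace X. a \<le> f g}"
      using Cc_continuous[OF f] by (simp add: continuous_map_upper_lower_semicontinuous_le)
    then have "closedin X (s ` ?C)"
      using L(1) compact_Int_closedin image_compactin[OF _ continuous_src] compact_closed by blast
    moreover have "{x \<in> topspace X. fibre_max f x < a} = topspace X - s ` ?C"
    proof (intro equalityI subsetI)
      fix x assume x: "x \<in> topspace X - s ` ?C"
      have "\<not> a \<le> fibre_max f x"
      proof
        assume a: "a \<le> fibre_max f x"
        then obtain g where "g \<in> arrows G" "s g = x" "f g = fibre_max f x"
          using False fibre_max_attained[OF f, of x] by auto
        then show False using x a False L(2)[of g] by auto
      qed
      then show "x \<in> {x \<in> topspace X. fibre_max f x < a}" using x by auto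
    next
      fix x assume x: "x \<in> {x \<in> topspace X. fibre_max f x < a}"
      have "x \<notin> s ` ?C"
      proof
        assume "x \<in> s ` ?C"
        then obtain g where "g \<in> arrows G" "a \<le> f g" "x = s g" by auto
        then show False using x fibre_max_ge[OF f, of g] by auto
      qed
      then show "x \<in> topspace X - s ` ?C" using x by auto
    qed
    ultimately show ?thesis by auto
  qed
qed

text \<open>
  On a bisection each fibre carries at most one nonzero value, so continuity of the sum reduces to
  that of the maximum.
\<close>

lemma fibre_sum_bisection:
  assumes f: "f \<in> Cc G H" and pos: "\<And>g. g \<in> arrows G \<Longrightarrow> 0 \<le> f g"
    and V: "inj_on s V" "\<And>g. g \<in> arrows G \<Longrightarrow> f g \<noteq> 0 \<Longrightarrow> g \<in> V"
  shows "fibre_sum G f x = fibre_max f x"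
proof (cases "fibre_max f x = 0")
  case True
  then have "f g = 0" if "g \<in> source_fibre G x" for g
    using that fibre_max_ge[OF f, of g] pos[of g] by (auto simp: source_fibre_iff)
  then show ?thesis using True by (simp add: fibre_sum_def infsum_0)
next
  case False
  then obtain g where g: "g \<in> arrows G" "s g = x" "f g = fibre_max f x"
    using fibre_max_attained[OF f] by metis
  have "infsum f (source_fibre G x) = infsum f {g}"
  proof (rule infsum_cong_neutral)
    fix h assume h: "h \<in> source_fibre G x - {g}"
    then show "f h = 0"
      using V(1) V(2)[of g] V(2)[of h] g False by (auto simp: source_fibre_iff inj_on_def)
  qed (use g in \<open>auto simp: source_fibre_iff\<close>)
  then show ?thesis using g by (simp add: fibre_sum_def)
qed

text \<open>
  Splitting \<open>f = b f + (1 - b) f\<close> separates a part supported in a bisection from a remainder that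
  vanishes where \<open>b = 1\<close>. Removing the \<open>b\<close> one at a time writes \<open>f\<close> as a sum of functions supported
  in bisections.
\<close>

lemma fibre_sum_continuous_cover:
  assumes "finite \<B>"
    and "\<And>b. b \<in> \<B> \<Longrightarrow> continuous_map X euclideanreal b \<and> (\<forall>g \<in> arrows G. 0 \<le> b g \<and> b g \<le> 1) \<and>
           inj_on s {g \<in> arrows G. b g \<noteq> 0}"
    and "f \<in> Cc G H" "\<And>g. g \<in> arrows G \<Longrightarrow> 0 \<le> f g"
    and "\<And>g. g \<in> arrows G \<Longrightarrow> f g \<noteq> 0 \<Longrightarrow> \<exists>b \<in> \<B>. b g = 1"
  shows "continuous_map X euclideanreal (fibre_sum G f)"
  using assms
proof (induction \<B> arbitrary: f rule: finite_induct)
  case empty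
  then have "fibre_sum G f x = 0" for x
    unfolding fibre_sum_def by (intro infsum_0) (auto simp: source_fibre_iff)
  then have "fibre_sum G f = (\<lambda>x. 0)" by blast
  then show ?case by simp
next
  case (insert b \<B>)
  let ?u = "\<lambda>g. b g * f g" and ?v = "\<lambda>g. (1 - b g) * f g"
  have b: "continuous_map X euclideanreal b" "\<And>g. g \<in> arrows G \<Longrightarrow> 0 \<le> b g \<and> b g \<le> 1"
      "inj_on s {g \<in> arrows G. b g \<noteq> 0}"
    using insert.prems(1)[of b] by auto
  have u: "?u \<in> Cc G H" using insert.prems(2) b(1) by (rule Cc_mult)
  have v: "?v \<in> Cc G H" using insert.prems(2) b(1)
    by (intro Cc_mult continuous_map_diff) auto
  have "fibre_sum G ?u x = fibre_max ?u x" for x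
    by (rule fibre_sum_bisection[OF u _ b(3)]) (use b(2) insert.prems(3) in auto)
  then have cu: "continuous_map X euclideanreal (fibre_sum G ?u)"
    using fibre_max_continuous[OF u] by presburger
  have cv: "continuous_map X euclideanreal (fibre_sum G ?v)"
  proof (rule insert.IH)
    show "?v \<in> Cc G H" by (rule v)
    show "\<exists>b \<in> \<B>. b g = 1" if "g \<in> arrows G" "?v g \<noteq> 0" for g
      using insert.prems(4)[of g] that by auto
    show "0 \<le> ?v g" if "g \<in> arrows G" for g
      using b(2)[OF that] insert.prems(3)[OF that] by simp
  qed (use insert.prems(1) in blast)
  have "fibre_sum G f x = fibre_sum G ?u x + fibre_sum G ?v x" for x
    using infsum_add[OF Cc_summable[OF u, of x] Cc_summable[OF v, of x]]
    by (simp add: fibre_sum_def algebra_simps)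
  then have "fibre_sum G f = (\<lambda>x. fibre_sum G ?u x + fibre_sum G ?v x)" by (rule ext)
  then show ?case using continuous_map_add[OF cu cv] by simp
qed

lemma fibre_sum_continuous:
  assumes f: "f \<in> Cc G H" and pos: "\<And>g. g \<in> arrows G \<Longrightarrow> 0 \<le> f g"
  shows "continuous_map X euclideanreal (fibre_sum G f)"
proof -
  obtain L where L: "compactin X L" "\<And>g. g \<in> arrows G \<Longrightarrow> f g \<noteq> 0 \<Longrightarrow> g \<in> L"
    using f Cc_support by metis
  define P where "P b \<longleftrightarrow> continuous_map X euclideanreal b \<and> (\<forall>g \<in> arrows G. 0 \<le> b g \<and> b g \<le> 1) \<and>
           inj_on s {g \<in> arrows G. b g \<noteq> 0}" for b
  have "\<exists>\<F>. finite \<F> \<and> \<F> \<subseteq> {W. openin X W \<and> (\<exists>b. P b \<and> (\<forall>g \<in> W. b g = 1))} \<and> L \<subseteq> \<Union>\<F>"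
  proof (rule compactinD[OF L(1)])
    show "L \<subseteq> \<Union>{W. openin X W \<and> (\<exists>b. P b \<and> (\<forall>g \<in> W. b g = 1))}"
    proof
      fix g assume "g \<in> L"
      then have g: "g \<in> arrows G" using compactin_subset_topspace[OF L(1)] by blast
      then obtain V where V: "openin X V" "g \<in> V" "inj_on s V"
        using local_homeomorphism_imp_locally_injective[OF src_local_homeomorphism] by metis
      obtain W A where W: "openin X W" "compactin X A" "{g} \<subseteq> W" "W \<subseteq> A" "A \<subseteq> V"
        by (rule compact_nbhd_in_open[OF lc hd, of "{g}" V]) (use g V in auto)
      obtain b where b: "b \<in> Cc G V" "\<And>g. g \<in> arrows G \<Longrightarrow> 0 \<le> b g \<and> b g \<le> 1"
          "\<And>g. g \<in> A \<Longrightarrow> b g = 1"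
        using bump_function[OF W(2) V(1) W(5)] by blast
      have "{g \<in> arrows G. b g \<noteq> 0} \<subseteq> V" using b(1) unfolding Cc_def by blast
      then have "P b" unfolding P_def using b Cc_continuous inj_on_subset[OF V(3)] by blast
      then show "g \<in> \<Union>{W. openin X W \<and> (\<exists>b. P b \<and> (\<forall>g \<in> W. b g = 1))}"
        using W b(3) by blast
    qed
  qed auto
  then obtain \<F> where \<F>: "finite \<F>" "L \<subseteq> \<Union>\<F>" "\<forall>W \<in> \<F>. \<exists>b. P b \<and> (\<forall>g \<in> W. b g = 1)"
    by (elim exE conjE, intro that) (assumption, assumption, blast)
  then obtain \<beta> where \<beta>: "\<forall>W \<in> \<F>. P (\<beta> W) \<and> (\<forall>g \<in> W. \<beta> W g = 1)" by metis
  show ?thesis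
  proof (rule fibre_sum_continuous_cover[of "\<beta> ` \<F>", OF _ _ f pos])
    show "\<exists>b \<in> \<beta> ` \<F>. b g = 1" if "g \<in> arrows G" "f g \<noteq> 0" for g
      using L(2)[OF that] \<F>(2) \<beta> by blast
  qed (use \<F>(1) \<beta> in \<open>auto simp: P_def\<close>)
qed

lemma fibre_sum_translate:
  assumes "k \<in> arrows G"
  shows "(\<Sum>\<^sub>\<infinity>g\<in>source_fibre G (r k). f (g \<cdot> k)) = fibre_sum G f (s k)"
  unfolding fibre_sum_def by (rule infsum_reindex_bij_betw[OF bij_betw_fibres[OF assms]])

lemma summable_translate:
  assumes "k \<in> arrows G" "f \<in> Cc G H"
  shows "(\<lambda>g. f (g \<cdot> k)) summable_on source_fibre G (r k)"
  using summable_on_reindex_bij_betw[OF bij_betw_fibres[OF assms(1)], of f] Cc_summable[OF assms(2)]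
  by blast

lemma summable_displacement:
  assumes k: "k \<in> arrows G" and f: "f \<in> Cc G H"
  shows "(\<lambda>g. \<bar>f g - f (g \<cdot> k)\<bar>) summable_on source_fibre G (r k)"
proof -
  have "(\<lambda>g. f g - f (g \<cdot> k)) summable_on source_fibre G (r k)"
    using summable_on_add[OF Cc_summable[OF f, of "r k"], of "\<lambda>g. - f (g \<cdot> k)"]
      summable_translate[OF k f] by (simp add: summable_on_uminus)
  then have "(\<lambda>g. norm (f g - f (g \<cdot> k))) summable_on source_fibre G (r k)"
    by (rule iffD1[OF summable_on_iff_abs_summable_on_real])
  then show ?thesis by simp
qed

lemma fibre_sum_diff_le_displacement:
  assumes k: "k \<in> arrows G" and f: "f \<in> Cc G H"
  shows "\<bar>fibre_sum G f (r k) - fibre_sum G f (s k)\<bar> \<le> displacement G f k"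
proof -
  let ?A = "source_fibre G (r k)"
  note sm = Cc_summable[OF f, of "r k"] summable_translate[OF k f] summable_displacement[OF k f]
  have "infsum f ?A \<le> infsum (\<lambda>g. f (g \<cdot> k) + \<bar>f g - f (g \<cdot> k)\<bar>) ?A"
    by (intro infsum_mono sm summable_on_add) auto
  moreover have "infsum (\<lambda>g. f (g \<cdot> k)) ?A \<le> infsum (\<lambda>g. f g + \<bar>f g - f (g \<cdot> k)\<bar>) ?A"
    by (intro infsum_mono sm summable_on_add) auto
  ultimately show ?thesis
    using fibre_sum_translate[OF k, of f] sm
    by (simp add: infsum_add displacement_def fibre_sum_def)
qed

text \<open>
  Fibre sums differ by at most the displacement, so dividing by them costs at most another copy of
  it. Truncating the divisor below at 1 keeps the quotient continuous where the sums vanish.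
\<close>

lemma normalise:
  assumes f: "f \<in> Cc G H" and pos: "\<And>g. g \<in> arrows G \<Longrightarrow> 0 \<le> f g"
  obtains \<mu> where "\<mu> \<in> Cc G H" "\<And>g. g \<in> arrows G \<Longrightarrow> 0 \<le> \<mu> g" "\<And>x. fibre_sum G \<mu> x \<le> 1"
    "\<And>x. 1 \<le> fibre_sum G f x \<Longrightarrow> fibre_sum G \<mu> x = 1"
    "\<And>k. k \<in> arrows G \<Longrightarrow> 1 \<le> fibre_sum G f (s k) \<Longrightarrow> 1 \<le> fibre_sum G f (r k) \<Longrightarrow>
        displacement G \<mu> k \<le> 2 * displacement G f k"
proof -
  let ?F = "fibre_sum G f"
  define D where "D x = max 1 (?F x)" for x
  define \<mu> where "\<mu> g = inverse (D (s g)) * f g" for g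
  have D1: "1 \<le> D x" for x by (simp add: D_def)
  then have D0: "D x \<noteq> 0" "0 < D x" for x by (smt (verit, best))+
  have "continuous_map X euclideanreal D"
    unfolding D_def using fibre_sum_continuous[OF f pos] by (intro continuous_map_real_max) auto
  then have "continuous_map X euclideanreal (\<lambda>g. D (s g))"
    using continuous_map_compose[OF continuous_src] by (auto simp: o_def)
  then have \<mu>: "\<mu> \<in> Cc G H"
    unfolding \<mu>_def by (intro Cc_mult[OF f] continuous_map_real_inverse) (auto simp: D0)
  have sum: "fibre_sum G \<mu> x = inverse (D x) * ?F x" for x
  proof -
    have "fibre_sum G \<mu> x = infsum (\<lambda>g. inverse (D x) * f g) (source_fibre G x)"
      unfolding fibre_sum_def \<mu>_def by (rule infsum_cong) (auto simp: source_fibre_iff)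
    then show ?thesis by (simp add: infsum_cmult_right' fibre_sum_def)
  qed
  show ?thesis
  proof
    show "\<mu> \<in> Cc G H" by (rule \<mu>)
    show "0 \<le> \<mu> g" if "g \<in> arrows G" for g
      using pos[OF that] D0(2)[of "s g"] by (simp add: \<mu>_def)
    show "fibre_sum G \<mu> x \<le> 1" for x
      using D0(2)[of x] by (simp add: sum D_def field_simps)
    show "fibre_sum G \<mu> x = 1" if "1 \<le> ?F x" for x
      using that D0[of x] by (simp add: sum D_def)
    fix k assume k: "k \<in> arrows G" and F: "1 \<le> ?F (s k)" "1 \<le> ?F (r k)"
    let ?A = "source_fibre G (r k)" and ?a = "?F (r k)" and ?b = "?F (s k)"
    let ?c = "\<bar>inverse ?a - inverse ?b\<bar>"
    have a: "D (r k) = ?a" "D (s k) = ?b" using F by (auto simp: D_def)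
    have bound: "\<bar>\<mu> g - \<mu> (g \<cdot> k)\<bar> \<le> \<bar>f g - f (g \<cdot> k)\<bar> + ?c * f (g \<cdot> k)" if "g \<in> ?A" for g
    proof -
      have g: "g \<in> arrows G" "s g = r k" "g \<cdot> k \<in> arrows G" "s (g \<cdot> k) = s k"
        using that k by (auto simp: source_fibre_iff mult_closed src_mult composable_iff)
      have "\<mu> g - \<mu> (g \<cdot> k) = inverse ?a * (f g - f (g \<cdot> k)) + (inverse ?a - inverse ?b) * f (g \<cdot> k)"
        using g a by (simp add: \<mu>_def algebra_simps)
      also have "\<bar>\<dots>\<bar> \<le> inverse ?a * \<bar>f g - f (g \<cdot> k)\<bar> + ?c * f (g \<cdot> k)"
        using F pos[OF g(3)] by (intro order.trans[OF abs_triangle_ineq]) (simp add: abs_mult)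
      also have "inverse ?a * \<bar>f g - f (g \<cdot> k)\<bar> \<le> 1 * \<bar>f g - f (g \<cdot> k)\<bar>"
        using F by (intro mult_right_mono) (auto simp: field_simps)
      finally show ?thesis by simp
    qed
    have "displacement G \<mu> k \<le> infsum (\<lambda>g. \<bar>f g - f (g \<cdot> k)\<bar> + ?c * f (g \<cdot> k)) ?A"
      unfolding displacement_def
      by (intro infsum_mono bound summable_on_add summable_on_cmult_right
            summable_displacement[OF k \<mu>] summable_displacement[OF k f] summable_translate[OF k f])
    also have "\<dots> = displacement G f k + ?c * ?b"
      using fibre_sum_translate[OF k, of f]
      by (subst infsum_add) (auto intro!: summable_on_cmult_right summable_displacement[OF k f]
           summable_translate[OF k f] simp: displacement_def infsum_cmult_right')
    also have "?c * ?b = \<bar>?a - ?b\<bar> / ?a"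
      using F by (simp add: abs_mult abs_if field_simps)
    also have "\<dots> \<le> \<bar>?a - ?b\<bar>"
      using F mult_right_mono[of 1 ?a "\<bar>?a - ?b\<bar>"] by (simp add: field_simps)
    also have "\<dots> \<le> displacement G f k" by (rule fibre_sum_diff_le_displacement[OF k f])
    finally show "displacement G \<mu> k \<le> 2 * displacement G f k" by simp
  qed
qed

section \<open>Amenability of open subgroupoids\<close>

lemma fibre_sum_ge:
  assumes f: "f \<in> Cc G H" and pos: "\<And>g. g \<in> arrows G \<Longrightarrow> 0 \<le> f g" and g: "g \<in> arrows G"
  shows "f g \<le> fibre_sum G f (s g)"
  using finite_sum_le_infsum[OF Cc_summable[OF f], of "{g}" "s g"] pos g
  by (simp add: fibre_sum_def source_fibre_iff)

lemma inv_unit: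
  assumes "x \<in> units G" shows "inv x = x"
proof -
  have x: "x \<in> arrows G" "s x = x" "r x = x"
    using assms rng_src[of x] by (auto simp: units_iff)
  then have "inv x \<cdot> x = inv x" using mult_src[of "inv x"] by (simp add: inv_closed src_inv)
  then show ?thesis using inv_mult[of x] x by simp
qed

lemma subgroupoid_inv_image: "subgroupoid G H \<Longrightarrow> A \<subseteq> H \<Longrightarrow> inv ` A \<subseteq> H"
  unfolding subgroupoid_def by blast

lemma subgroupoid_set_mult: "subgroupoid G H \<Longrightarrow> A \<subseteq> H \<Longrightarrow> B \<subseteq> H \<Longrightarrow> set_mult G A B \<subseteq> H"
  unfolding subgroupoid_def set_mult_def by blast

text \<open>
  A criterion free of normalisation: \<open>K\<close> may be enlarged to be closed under sources and inverses,
  and fibre sums need only be bounded below on \<open>s(K)\<close>, as \<open>normalise\<close> does the rest.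
\<close>

lemma amenable_onI:
  assumes H: "subgroupoid G H"
    and ex: "\<And>K \<delta>. compactin X K \<Longrightarrow> K \<subseteq> H \<Longrightarrow> (\<And>k. k \<in> K \<Longrightarrow> s k \<in> K \<and> inv k \<in> K) \<Longrightarrow> \<delta> > 0 \<Longrightarrow>
        \<exists>f \<in> Cc G H. (\<forall>g \<in> arrows G. 0 \<le> f g) \<and>
          (\<forall>k \<in> K. 1 \<le> fibre_sum G f (s k) \<and> displacement G f k \<le> \<delta>)"
  shows "amenable_on G H"
  unfolding amenable_on_def
proof (intro allI impI, elim conjE)
  fix K :: "'a set" and \<epsilon> :: real
  assume K: "compactin X K" "K \<subseteq> H" and \<epsilon>: "\<epsilon> > 0"
  have KG: "K \<subseteq> arrows G" using compactin_subset_topspace[OF K(1)] .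
  define K' where "K' = K \<union> inv ` K \<union> s ` K \<union> r ` K"
  have "\<exists>f \<in> Cc G H. (\<forall>g \<in> arrows G. 0 \<le> f g) \<and>
          (\<forall>k \<in> K'. 1 \<le> fibre_sum G f (s k) \<and> displacement G f k \<le> \<epsilon> / 3)"
  proof (rule ex)
    show "compactin X K'"
      unfolding K'_def
      using K(1) image_compactin[OF K(1)] continuous_inv continuous_src continuous_rng
      by (intro compactin_Un) blast+
    show "K' \<subseteq> H" using K(2) H by (auto simp: K'_def subgroupoid_def)
    fix k assume "k \<in> K'"
    then show "s k \<in> K' \<and> inv k \<in> K'"
      using KG by (auto simp: K'_def src_inv src_src src_rng inv_inv inv_unit src_in_units rng_in_units)
  qed (use \<epsilon> in simp)
  then obtain f where f: "f \<in> Cc G H" "\<And>g. g \<in> arrows G \<Longrightarrow> 0 \<le> f g"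
      "\<And>k. k \<in> K' \<Longrightarrow> 1 \<le> fibre_sum G f (s k)" "\<And>k. k \<in> K' \<Longrightarrow> displacement G f k \<le> \<epsilon> / 3"
    by blast
  obtain \<mu> where \<mu>: "\<mu> \<in> Cc G H" "\<And>g. g \<in> arrows G \<Longrightarrow> 0 \<le> \<mu> g" "\<And>x. fibre_sum G \<mu> x \<le> 1"
    "\<And>x. 1 \<le> fibre_sum G f x \<Longrightarrow> fibre_sum G \<mu> x = 1"
    "\<And>k. k \<in> arrows G \<Longrightarrow> 1 \<le> fibre_sum G f (s k) \<Longrightarrow> 1 \<le> fibre_sum G f (r k) \<Longrightarrow>
        displacement G \<mu> k \<le> 2 * displacement G f k"
    using normalise[OF f(1,2)] by blast
  have "fibre_sum G \<mu> (s k) = 1 \<and> fibre_sum G \<mu> (r k) = 1 \<and> displacement G \<mu> k < \<epsilon>"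
    if k: "k \<in> K" for k
  proof -
    have "k \<in> arrows G" "k \<in> K'" "r k \<in> K'" "s (r k) = r k"
      using k KG by (auto simp: K'_def src_rng)
    then show ?thesis
      using f(3)[of k] f(3)[of "r k"] f(4)[of k] \<mu>(4)[of "s k"] \<mu>(4)[of "r k"] \<mu>(5)[of k] \<epsilon> by auto
  qed
  then show "\<exists>\<mu> \<in> Cc G H. (\<forall>g \<in> arrows G. 0 \<le> \<mu> g) \<and> (\<forall>x \<in> units G. fibre_sum G \<mu> x \<le> 1) \<and>
      (\<forall>k \<in> K. fibre_sum G \<mu> (s k) = 1 \<and> fibre_sum G \<mu> (r k) = 1 \<and> displacement G \<mu> k < \<epsilon>)"
    using \<mu>(1-3) by blast
qed

text \<open>
  A staircase: each step adds a bump that equals 1 on the support \<open>S\<close> of the previous function and on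
  \<open>S K\<close> and \<open>S K\<inverse>\<close>. If the previous function is nonzero at \<open>h\<close> or \<open>hk\<close>, the new bump is 1 at both and
  the difference is unchanged; otherwise only the new bump contributes, and by at most 1. So the
  height grows while the variation along \<open>K\<close> stays bounded by 1.
\<close>

lemma slow_bump_steps:
  assumes H: "subgroupoid G H" "openin X H" and K: "compactin X K" "K \<subseteq> H"
  shows "\<exists>w \<in> Cc G H. (\<forall>g \<in> arrows G. 0 \<le> w g \<and> w g \<le> real n) \<and> (\<forall>g \<in> K. w g = real n) \<and>
    (\<forall>h \<in> arrows G. \<forall>k \<in> K. s h = r k \<longrightarrow> \<bar>w h - w (h \<cdot> k)\<bar> \<le> 1)"
proof (induction n)
  case 0
  have "(\<lambda>g. 0) \<in> Cc G H" by (rule CcI[of _ "{}"]) auto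
  then show ?case by (intro bexI[of _ "\<lambda>g. 0"]) auto
next
  case (Suc n)
  then obtain w where w: "w \<in> Cc G H" "\<And>g. g \<in> arrows G \<Longrightarrow> 0 \<le> w g \<and> w g \<le> real n"
      "\<And>g. g \<in> K \<Longrightarrow> w g = real n"
      "\<And>h k. h \<in> arrows G \<Longrightarrow> k \<in> K \<Longrightarrow> s h = r k \<Longrightarrow> \<bar>w h - w (h \<cdot> k)\<bar> \<le> 1"
    by blast
  obtain S where S: "compactin X S" "S \<subseteq> H" "\<And>g. g \<in> arrows G \<Longrightarrow> w g \<noteq> 0 \<Longrightarrow> g \<in> S"
    using w(1) Cc_support by blast
  let ?T = "K \<union> S \<union> set_mult G S K \<union> set_mult G S (inv ` K)"
  have T: "compactin X ?T"
    using K(1) S(1) by (intro compactin_Un compact_set_mult compact_inv_image)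
  have TH: "?T \<subseteq> H"
    using K(2) S(2) H(1) by (intro Un_least subgroupoid_set_mult subgroupoid_inv_image)
  obtain c where c: "c \<in> Cc G H" "\<And>g. g \<in> arrows G \<Longrightarrow> 0 \<le> c g \<and> c g \<le> 1" "\<And>g. g \<in> ?T \<Longrightarrow> c g = 1"
    using bump_function[OF T H(2) TH] by blast
  have slow: "\<bar>(w h + c h) - (w (h \<cdot> k) + c (h \<cdot> k))\<bar> \<le> 1"
    if h: "h \<in> arrows G" and k: "k \<in> K" and hk: "s h = r k" for h k
  proof -
    have kG: "k \<in> arrows G" using k compactin_subset_topspace[OF K(1)] by blast
    then have hkG: "h \<cdot> k \<in> arrows G" using h hk by (simp add: mult_closed composable_iff)
    show ?thesis
    proof (cases "w h = 0 \<and> w (h \<cdot> k) = 0")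
      case True
      then show ?thesis using c(2)[OF h] c(2)[OF hkG] by auto
    next
      case False
      have "h \<in> ?T \<and> h \<cdot> k \<in> ?T"
      proof (cases "w h = 0")
        case True
        then have "h \<cdot> k \<in> S" using False S(3)[OF hkG] by blast
        moreover from this have "h \<cdot> k \<cdot> inv k \<in> set_mult G S (inv ` K)"
          using k h kG hk by (intro set_multI) (auto simp: src_mult rng_inv composable_iff)
        ultimately show ?thesis using mul_inv_cancel[OF h kG hk] by simp
      next
        case False
        then show ?thesis using S(3)[OF h] set_multI[OF _ k hk] by blast
      qed
      then show ?thesis using c(3)[of h] c(3)[of "h \<cdot> k"] w(4)[OF h k hk] by auto
    qed
  qed
  show ?case
  proof (intro bexI[of _ "\<lambda>g. w g + c g"] conjI ballI impI)
    fix g assume "g \<in> K"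
    then show "w g + c g = real (Suc n)" using w(3)[of g] c(3)[of g] by auto
  qed (use w(2) c(2) slow Cc_add[OF w(1) c(1)] in \<open>force+\<close>)
qed

lemma slow_bump:
  assumes H: "subgroupoid G H" "openin X H" and K: "compactin X K" "K \<subseteq> H" and \<delta>: "\<delta> > 0"
  obtains w where "w \<in> Cc G H" "\<And>g. g \<in> arrows G \<Longrightarrow> 0 \<le> w g \<and> w g \<le> 1" "\<And>g. g \<in> K \<Longrightarrow> w g = 1"
    "\<And>h k. h \<in> arrows G \<Longrightarrow> k \<in> K \<Longrightarrow> s h = r k \<Longrightarrow> \<bar>w h - w (h \<cdot> k)\<bar> \<le> \<delta>"
proof -
  obtain n where n: "n > 0" "inverse (real n) < \<delta>" using ex_inverse_of_nat_less[OF \<delta>] by blast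
  obtain w where w: "w \<in> Cc G H" "\<And>g. g \<in> arrows G \<Longrightarrow> 0 \<le> w g \<and> w g \<le> real n"
      "\<And>g. g \<in> K \<Longrightarrow> w g = real n"
      "\<And>h k. h \<in> arrows G \<Longrightarrow> k \<in> K \<Longrightarrow> s h = r k \<Longrightarrow> \<bar>w h - w (h \<cdot> k)\<bar> \<le> 1"
    using slow_bump_steps[OF H K] by blast
  show ?thesis
  proof
    show "(\<lambda>g. inverse (real n) * w g) \<in> Cc G H" by (rule Cc_mult[OF w(1)]) simp
    show "0 \<le> inverse (real n) * w g \<and> inverse (real n) * w g \<le> 1" if "g \<in> arrows G" for g
      using w(2)[OF that] n(1) by (auto simp: field_simps)
    show "inverse (real n) * w g = 1" if "g \<in> K" for g
      using w(3)[OF that] n(1) by simp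
    show "\<bar>inverse (real n) * w h - inverse (real n) * w (h \<cdot> k)\<bar> \<le> \<delta>"
      if "h \<in> arrows G" "k \<in> K" "s h = r k" for h k
    proof -
      have "\<bar>inverse (real n) * w h - inverse (real n) * w (h \<cdot> k)\<bar> = inverse (real n) * \<bar>w h - w (h \<cdot> k)\<bar>"
        by (simp add: abs_mult right_diff_distrib[symmetric])
      also have "\<dots> \<le> inverse (real n) * 1" using w(4)[OF that] by (intro mult_left_mono) auto
      finally show ?thesis using n(2) by simp
    qed
  qed
qed

text \<open>
  The fibres of \<open>H\<close> have bounded cardinality, so a bump that varies slowly at each point has small
  displacement.
\<close>

lemma amenable_on_relatively_compact:
  assumes H: "subgroupoid G H" "openin X H" and rel: "relatively_compact_in X H"
  shows "amenable_on G H"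
proof (rule amenable_onI[OF H(1)])
  fix K and \<delta> :: real
  assume K: "compactin X K" "K \<subseteq> H" and sym: "\<And>k. k \<in> K \<Longrightarrow> s k \<in> K \<and> inv k \<in> K" and \<delta>: "\<delta> > 0"
  have HG: "H \<subseteq> arrows G" using H(1) by (simp add: subgroupoid_def)
  obtain N where N: "\<And>x. finite (source_fibre G x \<inter> X closure_of H) \<and>
      card (source_fibre G x \<inter> X closure_of H) \<le> N"
    using compact_fibre_bounded rel unfolding relatively_compact_in_def by metis
  let ?\<eta> = "\<delta> / (real N + 1)"
  have "?\<eta> > 0" using \<delta> by simp
  then obtain w where w: "w \<in> Cc G H" "\<And>g. g \<in> arrows G \<Longrightarrow> 0 \<le> w g \<and> w g \<le> 1" "\<And>g. g \<in> K \<Longrightarrow> w g = 1"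
    "\<And>h k. h \<in> arrows G \<Longrightarrow> k \<in> K \<Longrightarrow> s h = r k \<Longrightarrow> \<bar>w h - w (h \<cdot> k)\<bar> \<le> ?\<eta>"
    using slow_bump[OF H K] by blast
  have off: "w g = 0" if "g \<in> arrows G" "g \<notin> H" for g
    using w(1) that unfolding Cc_def by blast
  have "displacement G w k \<le> \<delta>" if k: "k \<in> K" for k
  proof -
    have kH: "k \<in> H" "k \<in> arrows G" using k K(2) HG by auto
    let ?A = "source_fibre G (r k) \<inter> X closure_of H"
    have "displacement G w k = infsum (\<lambda>g. \<bar>w g - w (g \<cdot> k)\<bar>) ?A"
      unfolding displacement_def
    proof (rule infsum_cong_neutral)
      fix g assume g: "g \<in> source_fibre G (r k) - ?A"
      then have gG: "g \<in> arrows G" "s g = r k" "g \<cdot> k \<in> arrows G"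
        using kH by (auto simp: source_fibre_iff mult_closed composable_iff)
      have gH: "g \<notin> H" using g closure_of_subset[OF HG] by auto
      moreover have "g \<cdot> k \<notin> H"
      proof
        assume "g \<cdot> k \<in> H"
        then have "g \<cdot> k \<cdot> inv k \<in> H"
          using H(1) kH gG by (simp add: subgroupoid_def src_mult rng_inv composable_iff)
        then show False using gH mul_inv_cancel gG kH by simp
      qed
      ultimately show "\<bar>w g - w (g \<cdot> k)\<bar> = 0" using off gG by simp
    qed auto
    also have "\<dots> = (\<Sum>g\<in>?A. \<bar>w g - w (g \<cdot> k)\<bar>)" using N by simp
    also have "\<dots> \<le> of_nat (card ?A) * ?\<eta>"
      using w(4) k by (intro sum_bounded_above) (auto simp: source_fibre_iff)
    also have "\<dots> \<le> real N * ?\<eta>"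
      using N \<open>?\<eta> > 0\<close> by (intro mult_right_mono) auto
    also have "\<dots> \<le> \<delta>" using \<delta> by (simp add: field_simps)
    finally show ?thesis .
  qed
  moreover have "1 \<le> fibre_sum G w (s k)" if "k \<in> K" for k
    using fibre_sum_ge[OF w(1), of "s k"] w(2) w(3)[of "s k"] sym[OF that] that K(2) HG
    by (auto simp: src_src src_closed subset_iff)
  ultimately show "\<exists>f \<in> Cc G H. (\<forall>g \<in> arrows G. 0 \<le> f g) \<and>
          (\<forall>k \<in> K. 1 \<le> fibre_sum G f (s k) \<and> displacement G f k \<le> \<delta>)"
    using w(1,2) by blast
qed

text \<open>
  This is the contribution of one member \<open>U\<close> of the cover. The cut-off \<open>\<phi>\<close> is a fibrewise maximum,
  not a sum, because the maximum varies by at most \<open>\<delta>\<close> regardless of how many arrows of \<open>L\<close> lie over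
  a unit, a number that depends on \<open>w\<close> and hence on \<open>\<delta>\<close>.
\<close>

lemma localised_mean:
  assumes H: "subgroupoid G H" and K: "compactin X K" "\<And>k. k \<in> K \<Longrightarrow> s k \<in> K \<and> inv k \<in> K"
    and w: "w \<in> Cc G H" "\<And>g. g \<in> arrows G \<Longrightarrow> 0 \<le> w g \<and> w g \<le> 1" "\<And>g. g \<in> K \<Longrightarrow> w g = 1"
      "\<And>h k. h \<in> arrows G \<Longrightarrow> k \<in> K \<Longrightarrow> s h = r k \<Longrightarrow> \<bar>w h - w (h \<cdot> k)\<bar> \<le> \<delta>"
    and \<delta>: "\<delta> > 0"
    and L: "compactin X L" "\<And>g. g \<in> arrows G \<Longrightarrow> w g \<noteq> 0 \<Longrightarrow> g \<in> L"
    and U: "openin X U" and C: "compactin X C" "C \<subseteq> U"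
    and H': "subgroupoid G H'" "H' \<subseteq> H" "amenable_on G H'"
    and gen: "\<And>h. h \<in> L \<Longrightarrow> r h \<in> U \<Longrightarrow> inv h \<in> H'"
      "\<And>h k. h \<in> L \<Longrightarrow> k \<in> K \<Longrightarrow> s h = s k \<Longrightarrow> r h \<in> U \<Longrightarrow> k \<cdot> inv h \<in> H'"
  shows "\<exists>f \<in> Cc G H. (\<forall>g \<in> arrows G. 0 \<le> f g) \<and>
           (\<forall>k \<in> K. displacement G f k \<le> 2 * \<delta> \<and> (s k \<in> C \<longrightarrow> 1 \<le> fibre_sum G f (s k)))"
proof -
  have KG: "k \<in> arrows G" if "k \<in> K" for k using that compactin_subset_topspace[OF K(1)] by blast
  have LG: "h \<in> arrows G" if "h \<in> L" for h using that compactin_subset_topspace[OF L(1)] by blast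
  obtain \<psi> where \<psi>: "\<psi> \<in> Cc G U" "\<And>g. g \<in> arrows G \<Longrightarrow> 0 \<le> \<psi> g \<and> \<psi> g \<le> 1" "\<And>g. g \<in> C \<Longrightarrow> \<psi> g = 1"
    using bump_function[OF C(1) U C(2)] by blast
  obtain A where A: "compactin X A" "A \<subseteq> U" "\<And>g. g \<in> arrows G \<Longrightarrow> \<psi> g \<noteq> 0 \<Longrightarrow> g \<in> A"
    using \<psi>(1) Cc_support by blast
  define u where "u h = \<psi> (r h) * w h" for h
  have "continuous_map X euclideanreal (\<lambda>h. \<psi> (r h))"
    using continuous_map_compose[OF continuous_rng Cc_continuous[OF \<psi>(1)]] by (simp add: o_def)
  then have u: "u \<in> Cc G H" unfolding u_def by (intro Cc_mult[OF w(1)])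
  define LA where "LA = L \<inter> {h \<in> topspace X. r h \<in> A}"
  have LA: "compactin X LA"
    unfolding LA_def using L(1) closedin_continuous_map_preimage[OF continuous_rng compact_closed[OF A(1)]]
    by (rule compact_Int_closedin)
  have uLA: "h \<in> LA" if "h \<in> arrows G" "u h \<noteq> 0" for h
    using that L(2)[of h] A(3)[of "r h"] rng_closed[of h] by (auto simp: u_def LA_def)
  have LAD: "h \<in> L" "h \<in> arrows G" "r h \<in> U" if "h \<in> LA" for h
    using that A(2) by (auto simp: LA_def)
  define \<phi> where "\<phi> = fibre_max u"
  have \<phi>0: "0 \<le> \<phi> x" for x unfolding \<phi>_def by (rule fibre_max_nonneg[OF u])
  have u1: "u h \<le> 1" if "h \<in> arrows G" for h
    using w(2)[OF that] \<psi>(2)[OF rng_closed[OF that]] by (auto simp: u_def intro: mult_le_one)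
  have \<phi>1: "\<phi> x \<le> 1" for x
    unfolding \<phi>_def by (rule fibre_max_le[OF u]) (use u1 in \<open>auto simp: source_fibre_iff\<close>)
  have \<phi>_step: "\<phi> (r k) \<le> \<phi> (s k) + \<delta>" if k: "k \<in> K" for k
    unfolding \<phi>_def
  proof (rule fibre_max_le[OF u])
    show "0 \<le> fibre_max u (s k) + \<delta>" using fibre_max_nonneg[OF u, of "s k"] \<delta> by simp
    fix h assume "h \<in> source_fibre G (r k)"
    then have h: "h \<in> arrows G" "s h = r k" "h \<cdot> k \<in> arrows G" "r (h \<cdot> k) = r h" "s (h \<cdot> k) = s k"
      using KG[OF k] by (auto simp: source_fibre_iff mult_closed src_mult rng_mult composable_iff)
    have \<psi>h: "0 \<le> \<psi> (r h)" "\<psi> (r h) \<le> 1" using \<psi>(2)[OF rng_closed[OF h(1)]] by auto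
    have "u h \<le> \<psi> (r h) * (w (h \<cdot> k) + \<delta>)"
      unfolding u_def using w(4)[OF h(1) k h(2)] \<psi>h by (intro mult_left_mono) auto
    also have "\<dots> \<le> u (h \<cdot> k) + \<delta>"
      using \<psi>h \<delta> h mult_right_mono[of "\<psi> (r h)" 1 \<delta>] by (simp add: u_def distrib_left)
    also have "\<dots> \<le> fibre_max u (s k) + \<delta>" using fibre_max_ge[OF u h(3)] h(5) by simp
    finally show "u h \<le> fibre_max u (s k) + \<delta>" .
  qed
  have \<phi>_slow: "\<bar>\<phi> (r k) - \<phi> (s k)\<bar> \<le> \<delta>" if k: "k \<in> K" for k
    using \<phi>_step[OF k] \<phi>_step[of "inv k"] K(2)[OF k] KG[OF k] by (simp add: src_inv rng_inv abs_le_iff)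
  \<comment> \<open>A compact subset of \<open>H'\<close> that contains every \<open>k \<in> K\<close> at whose source \<open>\<phi>\<close> is nonzero.\<close>
  define P where "P = set_mult G (set_mult G K (inv ` LA)) LA"
  define Q where "Q = P \<union> inv ` P"
  have Q: "compactin X Q"
    unfolding Q_def P_def using K(1) LA by (intro compactin_Un compact_set_mult compact_inv_image)
  have PH': "P \<subseteq> H'"
  proof
    fix p assume "p \<in> P"
    then obtain k h h' where p: "p = k \<cdot> inv h \<cdot> h'" "k \<in> K" "h \<in> LA" "h' \<in> LA"
        "s k = r (inv h)" "s (k \<cdot> inv h) = r h'"
      unfolding P_def set_mult_def by auto
    have "k \<cdot> inv h \<in> H'" using gen(2)[of h k] LAD[OF p(3)] p by (simp add: rng_inv)
    moreover have "h' \<in> H'"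
    proof -
      have "inv h' \<in> H'" using gen(1) LAD[OF p(4)] by blast
      then have "inv (inv h') \<in> H'" using H'(1) by (simp add: subgroupoid_def)
      then show ?thesis using inv_inv LAD[OF p(4)] by simp
    qed
    ultimately show "p \<in> H'" using p(1,6) H'(1) by (simp add: subgroupoid_def)
  qed
  then have QH': "Q \<subseteq> H'" unfolding Q_def using subgroupoid_inv_image[OF H'(1)] by blast
  have P_mem: "k \<in> P" if k: "k \<in> K" and nz: "\<phi> (s k) \<noteq> 0" for k
  proof -
    obtain h where h: "h \<in> arrows G" "s h = s k" "u h \<noteq> 0"
      using fibre_max_attained[OF u, of "s k"] nz unfolding \<phi>_def by metis
    then have hLA: "h \<in> LA" using uLA by blast
    have kh: "k \<cdot> inv h \<in> set_mult G K (inv ` LA)"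
      using k hLA h by (intro set_multI) (auto simp: rng_inv)
    then have "k \<cdot> inv h \<cdot> h \<in> P"
      unfolding P_def using set_multI[OF kh hLA] h KG[OF k]
      by (simp add: src_mult composable_iff inv_closed rng_inv src_inv)
    then show ?thesis using inv_mul_cancel[OF KG[OF k] h(1)] h(2) by simp
  qed
  have Q_mem: "k \<in> Q" if k: "k \<in> K" and nz: "\<phi> (s k) \<noteq> 0 \<or> \<phi> (r k) \<noteq> 0" for k
  proof (cases "\<phi> (s k) = 0")
    case True
    then have "inv k \<in> P"
      using P_mem[of "inv k"] nz K(2)[OF k] KG[OF k] by (simp add: src_inv)
    then show ?thesis using inv_inv[OF KG[OF k]] unfolding Q_def by (metis UnI2 imageI)
  qed (use P_mem[OF k] Q_def in blast)
  obtain \<mu> where \<mu>: "\<mu> \<in> Cc G H'" "\<And>g. g \<in> arrows G \<Longrightarrow> 0 \<le> \<mu> g"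
      "\<And>x. x \<in> units G \<Longrightarrow> fibre_sum G \<mu> x \<le> 1"
      "\<And>k. k \<in> Q \<Longrightarrow> fibre_sum G \<mu> (s k) = 1" "\<And>k. k \<in> Q \<Longrightarrow> displacement G \<mu> k < \<delta>"
    using H'(3) Q QH' \<delta> unfolding amenable_on_def by metis
  define f where "f g = \<phi> (s g) * \<mu> g" for g
  have "continuous_map X euclideanreal (\<lambda>g. \<phi> (s g))"
    using continuous_map_compose[OF continuous_src fibre_max_continuous[OF u]]
    by (simp add: \<phi>_def o_def)
  then have f: "f \<in> Cc G H" unfolding f_def using Cc_mono[OF \<mu>(1) H'(2)] by (intro Cc_mult)
  have fsum: "fibre_sum G f x = \<phi> x * fibre_sum G \<mu> x" for x
  proof -
    have "fibre_sum G f x = infsum (\<lambda>g. \<phi> x * \<mu> g) (source_fibre G x)"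
      unfolding fibre_sum_def f_def by (rule infsum_cong) (auto simp: source_fibre_iff)
    then show ?thesis by (simp add: infsum_cmult_right' fibre_sum_def)
  qed
  have disp: "displacement G f k \<le> 2 * \<delta>" if k: "k \<in> K" for k
  proof -
    let ?A = "source_fibre G (r k)"
    have val: "f g = \<phi> (r k) * \<mu> g" "f (g \<cdot> k) = \<phi> (s k) * \<mu> (g \<cdot> k)" "g \<cdot> k \<in> arrows G"
      if "g \<in> ?A" for g
      using that KG[OF k] by (auto simp: f_def source_fibre_iff src_mult mult_closed composable_iff)
    show ?thesis
    proof (cases "\<phi> (s k) \<noteq> 0 \<or> \<phi> (r k) \<noteq> 0")
      case False
      then have "displacement G f k = 0"
        unfolding displacement_def using val by (intro infsum_0) simp
      then show ?thesis using \<delta> by simp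
    next
      case True
      then have kQ: "k \<in> Q" using Q_mem[OF k] by blast
      have bound: "\<bar>f g - f (g \<cdot> k)\<bar> \<le> \<bar>\<mu> g - \<mu> (g \<cdot> k)\<bar> + \<delta> * \<mu> (g \<cdot> k)" if g: "g \<in> ?A" for g
      proof -
        have "f g - f (g \<cdot> k) = \<phi> (r k) * (\<mu> g - \<mu> (g \<cdot> k)) + (\<phi> (r k) - \<phi> (s k)) * \<mu> (g \<cdot> k)"
          using val[OF g] by (simp add: algebra_simps)
        also have "\<bar>\<dots>\<bar> \<le> \<phi> (r k) * \<bar>\<mu> g - \<mu> (g \<cdot> k)\<bar> + \<bar>\<phi> (r k) - \<phi> (s k)\<bar> * \<mu> (g \<cdot> k)"
          using \<phi>0[of "r k"] \<mu>(2)[OF val(3)[OF g]]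
          by (intro order.trans[OF abs_triangle_ineq]) (simp add: abs_mult)
        also have "\<dots> \<le> 1 * \<bar>\<mu> g - \<mu> (g \<cdot> k)\<bar> + \<delta> * \<mu> (g \<cdot> k)"
          using \<phi>1[of "r k"] \<phi>_slow[OF k] \<mu>(2)[OF val(3)[OF g]]
          by (intro add_mono mult_right_mono) auto
        finally show ?thesis by simp
      qed
      have "displacement G f k \<le> infsum (\<lambda>g. \<bar>\<mu> g - \<mu> (g \<cdot> k)\<bar> + \<delta> * \<mu> (g \<cdot> k)) ?A"
        unfolding displacement_def
        by (intro infsum_mono bound summable_on_add summable_on_cmult_right
              summable_displacement[OF KG[OF k] f] summable_displacement[OF KG[OF k] \<mu>(1)]
              summable_translate[OF KG[OF k] \<mu>(1)])
      also have "\<dots> = displacement G \<mu> k + \<delta> * fibre_sum G \<mu> (s k)"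
        using fibre_sum_translate[OF KG[OF k], of \<mu>]
        by (subst infsum_add) (auto intro!: summable_on_cmult_right summable_displacement[OF KG[OF k] \<mu>(1)]
             summable_translate[OF KG[OF k] \<mu>(1)] simp: displacement_def infsum_cmult_right')
      also have "\<dots> \<le> 2 * \<delta>" using \<mu>(4,5)[OF kQ] by simp
      finally show ?thesis .
    qed
  qed
  have big: "1 \<le> fibre_sum G f (s k)" if k: "k \<in> K" and kC: "s k \<in> C" for k
  proof -
    have sk: "s k \<in> K" "s (s k) = s k" "r (s k) = s k" "s k \<in> arrows G"
      using K(2)[OF k] KG[OF k] by (auto simp: src_src rng_src src_closed)
    have "u (s k) = 1" using w(3)[OF sk(1)] \<psi>(3)[OF kC] sk by (simp add: u_def)
    then have "1 \<le> \<phi> (s k)" using fibre_max_ge[OF u sk(4)] sk(2) by (simp add: \<phi>_def)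
    moreover from this have "k \<in> Q" using Q_mem[OF k] by auto
    ultimately show ?thesis using \<mu>(4)[of k] fsum by simp
  qed
  have "0 \<le> f g" if "g \<in> arrows G" for g using \<phi>0 \<mu>(2)[OF that] by (simp add: f_def)
  then show ?thesis using f disp big by blast
qed

lemma amenable_on_decomposable:
  assumes H: "subgroupoid G H" "openin X H"
    and dec: "decomposable_over G H {H'. open_subgroupoid G H' \<and> amenable_on G H'}"
  shows "amenable_on G H"
proof (rule amenable_onI[OF H(1)])
  fix K and \<delta> :: real
  assume K: "compactin X K" "K \<subseteq> H" and sym: "\<And>k. k \<in> K \<Longrightarrow> s k \<in> K \<and> inv k \<in> K" and \<delta>: "\<delta> > 0"
  have HG: "H \<subseteq> arrows G" using H(1) by (simp add: subgroupoid_def)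
  have \<delta>4: "\<delta> / 4 > 0" using \<delta> by simp
  obtain w where w: "w \<in> Cc G H" "\<And>g. g \<in> arrows G \<Longrightarrow> 0 \<le> w g \<and> w g \<le> 1" "\<And>g. g \<in> K \<Longrightarrow> w g = 1"
    "\<And>h k. h \<in> arrows G \<Longrightarrow> k \<in> K \<Longrightarrow> s h = r k \<Longrightarrow> \<bar>w h - w (h \<cdot> k)\<bar> \<le> \<delta> / 4"
    using slow_bump[OF H K \<delta>4] by blast
  obtain L where L: "compactin X L" "L \<subseteq> H" "\<And>g. g \<in> arrows G \<Longrightarrow> w g \<noteq> 0 \<Longrightarrow> g \<in> L"
    using w(1) Cc_support by blast
  \<comment> \<open>Of these arrows, the ones that start in \<open>U\<^sub>i\<close> must lie in the \<open>i\<close>-th generated subgroupoid.\<close>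
  let ?M = "inv ` L \<union> set_mult G K (inv ` L)"
  have M: "compactin X ?M"
    using K(1) L(1) by (intro compactin_Un compact_set_mult compact_inv_image)
  have MH: "?M \<subseteq> H"
    using K(2) L(2) H(1) by (intro Un_least subgroupoid_set_mult subgroupoid_inv_image)
  obtain V A where V: "openin X V" "compactin X A" "?M \<subseteq> V" "V \<subseteq> A" "A \<subseteq> H"
    using compact_nbhd_in_open[OF lc hd M H(2) MH] by blast
  let ?XH = "subtopology X H"
  have "openin ?XH V" using V by (metis inf.absorb2 openin_subtopology_Int2 order_trans)
  moreover have "relatively_compact_in ?XH V"
  proof -
    have A: "compactin ?XH A" using V by (simp add: compactin_subtopology)
    then have "closedin ?XH A"
      by (rule compactin_imp_closedin[OF Hausdorff_space_subtopology[OF hd]])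
    then have "?XH closure_of V \<subseteq> A" using V(4) by (rule closure_of_minimal[rotated])
    then have "compactin ?XH (?XH closure_of V)"
      using closed_compactin[OF A] closedin_closure_of by blast
    then show ?thesis using V(4,5) HG by (auto simp: relatively_compact_in_def)
  qed
  ultimately obtain U0 U1 where U: "openin (subtopology X (s ` H)) U0" "openin (subtopology X (s ` H)) U1"
      "s ` H = U0 \<union> U1"
      "open_subgroupoid G (generated_subgroupoid G H {h \<in> V. s h \<in> U0})"
      "amenable_on G (generated_subgroupoid G H {h \<in> V. s h \<in> U0})"
      "open_subgroupoid G (generated_subgroupoid G H {h \<in> V. s h \<in> U1})"
      "amenable_on G (generated_subgroupoid G H {h \<in> V. s h \<in> U1})"
    using dec unfolding decomposable_over_def by (auto 0 4)
  have UX: "openin X U0" "openin X U1"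
    using U(1,2) open_src_image[OF H(2)] openin_trans_full by blast+
  have cK: "compactin X (s ` K)" using K(1) continuous_src image_compactin by blast
  have "s ` K \<subseteq> U0 \<union> U1" using K(2) U(3) by blast
  then obtain C0 C1 where C: "compactin X C0" "compactin X C1" "C0 \<subseteq> U0" "C1 \<subseteq> U1" "s ` K = C0 \<union> C1"
    using compact_split_two_open[OF lc hd cK UX] by blast
  have piece: "\<exists>f \<in> Cc G H. (\<forall>g \<in> arrows G. 0 \<le> f g) \<and>
      (\<forall>k \<in> K. displacement G f k \<le> 2 * (\<delta> / 4) \<and> (s k \<in> C \<longrightarrow> 1 \<le> fibre_sum G f (s k)))"
    if W: "openin X W" and C: "compactin X C" "C \<subseteq> W"
      and H': "open_subgroupoid G (generated_subgroupoid G H {h \<in> V. s h \<in> W})"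
        "amenable_on G (generated_subgroupoid G H {h \<in> V. s h \<in> W})" for W C
  proof (rule localised_mean[OF H(1) K(1) sym w \<delta>4 L(1,3) W C _ _ H'(2)])
    let ?S = "{h \<in> V. s h \<in> W}"
    show "subgroupoid G (generated_subgroupoid G H ?S)"
      using H'(1) by (simp add: open_subgroupoid_def)
    show "generated_subgroupoid G H ?S \<subseteq> H"
      unfolding generated_subgroupoid_def using H(1) V(4,5) by (intro hull_minimal) auto
    have S: "?S \<subseteq> generated_subgroupoid G H ?S"
      unfolding generated_subgroupoid_def by (rule hull_subset)
    show "inv h \<in> generated_subgroupoid G H ?S" if "h \<in> L" "r h \<in> W" for h
    proof -
      have "inv h \<in> V" "s (inv h) \<in> W"
        using that V(3) L(2) HG by (auto simp: src_inv subset_iff)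
      then show ?thesis using S by blast
    qed
    show "k \<cdot> inv h \<in> generated_subgroupoid G H ?S"
      if "h \<in> L" "k \<in> K" "s h = s k" "r h \<in> W" for h k
    proof -
      have G: "h \<in> arrows G" "k \<in> arrows G" using that L(2) K(2) HG by auto
      then have "k \<cdot> inv h \<in> set_mult G K (inv ` L)"
        using that by (intro set_multI) (auto simp: rng_inv)
      then have "k \<cdot> inv h \<in> V" using V(3) by blast
      moreover have "s (k \<cdot> inv h) \<in> W"
        using that G by (simp add: src_mult composable_iff inv_closed rng_inv src_inv)
      ultimately show ?thesis using S by blast
    qed
  qed
  obtain f0 where f0: "f0 \<in> Cc G H" "\<And>g. g \<in> arrows G \<Longrightarrow> 0 \<le> f0 g"
      "\<And>k. k \<in> K \<Longrightarrow> displacement G f0 k \<le> \<delta> / 2"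
      "\<And>k. k \<in> K \<Longrightarrow> s k \<in> C0 \<Longrightarrow> 1 \<le> fibre_sum G f0 (s k)"
    using piece[OF UX(1) C(1,3) U(4,5)] by auto
  obtain f1 where f1: "f1 \<in> Cc G H" "\<And>g. g \<in> arrows G \<Longrightarrow> 0 \<le> f1 g"
      "\<And>k. k \<in> K \<Longrightarrow> displacement G f1 k \<le> \<delta> / 2"
      "\<And>k. k \<in> K \<Longrightarrow> s k \<in> C1 \<Longrightarrow> 1 \<le> fibre_sum G f1 (s k)"
    using piece[OF UX(2) C(2,4) U(6,7)] by auto
  let ?f = "\<lambda>g. f0 g + f1 g"
  have f: "?f \<in> Cc G H" using f0(1) f1(1) by (rule Cc_add)
  have "1 \<le> fibre_sum G ?f (s k) \<and> displacement G ?f k \<le> \<delta>" if k: "k \<in> K" for k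
  proof
    have kG: "k \<in> arrows G" using k K(2) HG by blast
    have "fibre_sum G ?f (s k) = fibre_sum G f0 (s k) + fibre_sum G f1 (s k)"
      unfolding fibre_sum_def by (rule infsum_add[OF Cc_summable[OF f0(1)] Cc_summable[OF f1(1)]])
    moreover have "0 \<le> fibre_sum G f0 (s k)" "0 \<le> fibre_sum G f1 (s k)"
      unfolding fibre_sum_def using f0(2) f1(2) by (auto intro!: infsum_nonneg simp: source_fibre_iff)
    moreover have "s k \<in> C0 \<or> s k \<in> C1" using k C(5) by blast
    ultimately show "1 \<le> fibre_sum G ?f (s k)" using f0(4)[OF k] f1(4)[OF k] by auto
    have "displacement G ?f k \<le> infsum (\<lambda>g. \<bar>f0 g - f0 (g \<cdot> k)\<bar> + \<bar>f1 g - f1 (g \<cdot> k)\<bar>) (source_fibre G (r k))"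
      unfolding displacement_def
      by (intro infsum_mono summable_on_add summable_displacement[OF kG f]
           summable_displacement[OF kG f0(1)] summable_displacement[OF kG f1(1)]) auto
    also have "\<dots> = displacement G f0 k + displacement G f1 k"
      unfolding displacement_def
      by (rule infsum_add[OF summable_displacement[OF kG f0(1)] summable_displacement[OF kG f1(1)]])
    finally show "displacement G ?f k \<le> \<delta>" using f0(3)[OF k] f1(3)[OF k] by simp
  qed
  then show "\<exists>f \<in> Cc G H. (\<forall>g \<in> arrows G. 0 \<le> f g) \<and>
          (\<forall>k \<in> K. 1 \<le> fibre_sum G f (s k) \<and> displacement G f k \<le> \<delta>)"
    using f f0(2) f1(2) by (intro bexI[OF _ f]) auto
qed

lemma amenable_on_fdc_class:
  assumes "H \<in> fdc_class G" shows "amenable_on G H"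
proof -
  have "fdc_class G \<subseteq> {H. open_subgroupoid G H \<and> amenable_on G H}"
    unfolding fdc_class_def closed_under_decomposability_def
    using amenable_on_relatively_compact amenable_on_decomposable
    by (intro Inter_lower) (auto simp: open_subgroupoid_def)
  then show ?thesis using assms by blast
qed

lemma amenable_on_imp_amenable_groupoid:
  assumes "amenable_on G (arrows G)" shows "amenable_groupoid G"
  unfolding amenable_groupoid_def
proof (intro allI impI, elim conjE)
  fix K :: "'a set" and \<epsilon> :: real
  assume K: "compactin X K" and \<epsilon>: "0 < \<epsilon>"
  then obtain \<mu> where \<mu>: "\<mu> \<in> Cc G (arrows G)" "\<And>g. g \<in> arrows G \<Longrightarrow> 0 \<le> \<mu> g"
      "\<And>x. x \<in> units G \<Longrightarrow> fibre_sum G \<mu> x \<le> 1"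
      "\<And>k. k \<in> K \<Longrightarrow> fibre_sum G \<mu> (r k) = 1" "\<And>k. k \<in> K \<Longrightarrow> displacement G \<mu> k < \<epsilon>"
    using assms compactin_subset_topspace[OF K] unfolding amenable_on_def by metis
  obtain L where L: "compactin X L" "\<And>g. g \<in> arrows G \<Longrightarrow> \<mu> g \<noteq> 0 \<Longrightarrow> g \<in> L"
    using \<mu>(1) Cc_support by metis
  have "\<mu> g \<le> 1" if "g \<in> arrows G" for g
    using fibre_sum_ge[OF \<mu>(1,2) that] \<mu>(3)[OF src_in_units[OF that]] by simp
  then have cont: "continuous_map X (top_of_set {0..1}) \<mu>"
    using Cc_continuous[OF \<mu>(1)] \<mu>(2) by (auto simp: continuous_map_in_subtopology)
  have "X closure_of {g \<in> arrows G. \<mu> g \<noteq> 0} \<subseteq> L"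
    by (rule closure_of_minimal) (use L compact_closed in auto)
  then have "compactin X (X closure_of {g \<in> arrows G. \<mu> g \<noteq> 0})"
    using closed_compactin[OF L(1)] closedin_closure_of by blast
  then show "\<exists>\<mu> :: 'a \<Rightarrow> real. continuous_map X (top_of_set {0..1}) \<mu> \<and>
           compactin X (X closure_of {g \<in> arrows G. \<mu> g \<noteq> 0}) \<and>
           (\<forall>x \<in> units G. (\<Sum>\<^sub>\<infinity>g\<in>source_fibre G x. \<mu> g) \<le> 1) \<and>
           (\<forall>k \<in> K. \<bar>1 - (\<Sum>\<^sub>\<infinity>g\<in>source_fibre G (r k). \<mu> g)\<bar> < \<epsilon>) \<and>
           (\<forall>k \<in> K. (\<Sum>\<^sub>\<infinity>g\<in>source_fibre G (r k). \<bar>\<mu> g - \<mu> (g \<cdot> k)\<bar>) < \<epsilon>)"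
    using cont \<mu>(3-5) \<epsilon> by (intro exI[of _ \<mu>]) (auto simp: fibre_sum_def displacement_def)
qed

end

theorem theoremA9:
  fixes G :: "'g groupoid_struct"
  assumes "etale_groupoid G"
    and "locally_compact_space (gtop G)"
    and "Hausdorff_space (gtop G)"
    and "finite_dynamical_complexity G"
  shows "amenable_groupoid G"
proof -
  interpret lch_etale_groupoid G
    using assms(1-3) by (simp add: lch_etale_groupoid_def lch_etale_groupoid_axioms_def)
  show ?thesis
    using assms(4) amenable_on_fdc_class amenable_on_imp_amenable_groupoid
    by (simp add: finite_dynamical_complexity_def)
qed

end
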